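(* \textsc{Maximum Happy Vertices} admits a kernel with $O(d^3)$ vertices, where $d$ is the distance to clique of the input graph, even when neither $d$ nor a clique modulator of the input graph is given explicitly.
   Context: All graphs are finite, simple and undirected; $[\ell]=\{1,\dots,\ell\}$. Given a coloring $c:V(G)\to[\ell]$, a vertex $v$ is happy if $c(u)=c(v)$ for every neighbour $u$ of $v$. \textsc{Maximum Happy Vertices}: given a graph $G$, a partial coloring $p: X\to[\ell]$ for some $X\subseteq V(G)$, and an integer $k$, decide whether there is a coloring $c:V(G)\to[\ell]$ extending $p$ with at least $k$ happy vertices. A clique modulator of $G$ is a set $S\subseteq V(G)$ such that $G-S$ is a clique; the distance to clique is the minimum size of a clique modulator. A kernel is a polynomial-time algorithm outputting an equivalent instance of \textsc{Maximum Happy Vertices} whose number of vertices is bounded as stated. *)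

theory Defs
  imports
    Complex_Main
    "HOL-Library.FuncSet"
    "HOL-Library.Log_Nat"
    "HOL-Library.Landau_Symbols"
    "HOL-Computational_Algebra.Polynomial"
begin

record 'a ugraph =
  verts :: "'a set"
  edges :: "'a set set"

definition simple_graph :: "'a ugraph \<Rightarrow> bool" where
  "simple_graph G \<longleftrightarrow>
     finite (verts G) \<and> (\<forall>e \<in> edges G. e \<subseteq> verts G \<and> card e = 2)"

definition is_clique :: "'a ugraph \<Rightarrow> 'a set \<Rightarrow> bool" where
  "is_clique G C \<longleftrightarrow>
     C \<subseteq> verts G \<and> (\<forall>u \<in> C. \<forall>v \<in> C. u \<noteq> v \<longrightarrow> {u, v} \<in> edges G)"

definition clique_modulator :: "'a ugraph \<Rightarrow> 'a set \<Rightarrow> bool" where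
  "clique_modulator G S \<longleftrightarrow> S \<subseteq> verts G \<and> is_clique G (verts G - S)"

text \<open>The empty set counts as a clique, so a modulator always exists.\<close>

definition dist_to_clique :: "'a ugraph \<Rightarrow> nat" where
  "dist_to_clique G = (LEAST d. \<exists>S. clique_modulator G S \<and> card S = d)"

record 'a mhv =
  graph :: "'a ugraph"
  num_colors :: nat
  precoloring :: "'a \<rightharpoonup> nat"
  threshold :: int

definition wf_mhv :: "'a mhv \<Rightarrow> bool" where
  "wf_mhv I \<longleftrightarrow>
     simple_graph (graph I) \<and>
     dom (precoloring I) \<subseteq> verts (graph I) \<and>
     ran (precoloring I) \<subseteq> {1..num_colors I}"

definition happy :: "'a ugraph \<Rightarrow> ('a \<Rightarrow> nat) \<Rightarrow> 'a \<Rightarrow> bool" where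
  "happy G c v \<longleftrightarrow> (\<forall>u. {u, v} \<in> edges G \<longrightarrow> c u = c v)"

definition extends :: "('a \<Rightarrow> nat) \<Rightarrow> ('a \<rightharpoonup> nat) \<Rightarrow> bool" where
  "extends c p \<longleftrightarrow> (\<forall>v a. p v = Some a \<longrightarrow> c v = a)"

definition mhv_yes :: "'a mhv \<Rightarrow> bool" where
  "mhv_yes I \<longleftrightarrow>
     (\<exists>c \<in> verts (graph I) \<rightarrow> {1..num_colors I}.
        extends c (precoloring I) \<and>
        int (card {v \<in> verts (graph I). happy (graph I) c v}) \<ge> threshold I)"

text \<open>Instances handed to an algorithm have their \<open>n\<close> vertices numbered \<open>0, \<dots>, n - 1\<close>.\<close>

definition mhv_instances :: "nat mhv set" where
  "mhv_instances =
     {I. wf_mhv I \<and> verts (graph I) = {..<card (verts (graph I))}}"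

text \<open>An instance is written as the number of vertices, the number of colors, the threshold,
  the list of prescribed colors (with \<open>0\<close>, which is not a color, for vertices that are not
  precolored) and the adjacency matrix, row by row. The header makes this self-delimiting.\<close>

definition encode_mhv :: "nat mhv \<Rightarrow> int list" where
  "encode_mhv I =
     (let n = card (verts (graph I)) in
        [int n, int (num_colors I), threshold I]
        @ map (\<lambda>v. case precoloring I v of None \<Rightarrow> 0 | Some a \<Rightarrow> int a) [0..<n]
        @ concat (map (\<lambda>u. map (\<lambda>v. if {u, v} \<in> edges (graph I) then 1 else 0) [0..<n]) [0..<n]))"

text \<open>
  The machine model is a structured random access machine: a memory consisting of integer cells,
  organised in arrays, with indirect addressing. A program mentions only finitely many arrays, so
  this amounts to a single memory with interleaved arrays. The only arithmetic operations are
  addition and subtraction, and time is counted with unit cost: one unit per assignment, skip and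
  test. Expressions are part of the program, so their size is a constant. As there is no
  multiplication, the bit length of all values grows by at most a constant per time unit;
  therefore polynomial time on this model coincides with polynomial time on Turing machines.
\<close>

type_synonym state = "nat \<Rightarrow> int \<Rightarrow> int"

datatype aexp =
    Const int
  | Cell nat aexp
  | Plus aexp aexp
  | Minus aexp aexp

fun aval :: "aexp \<Rightarrow> state \<Rightarrow> int" where
  "aval (Const z) s = z"
| "aval (Cell a e) s = s a (aval e s)"
| "aval (Plus e1 e2) s = aval e1 s + aval e2 s"
| "aval (Minus e1 e2) s = aval e1 s - aval e2 s"

datatype bexp =
    Less aexp aexp
  | Neg bexp
  | Conj bexp bexp

fun bval :: "bexp \<Rightarrow> state \<Rightarrow> bool" where
  "bval (Less e1 e2) s \<longleftrightarrow> aval e1 s < aval e2 s"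
| "bval (Neg b) s \<longleftrightarrow> \<not> bval b s"
| "bval (Conj b1 b2) s \<longleftrightarrow> bval b1 s \<and> bval b2 s"

datatype com =
    Skip
  | Assign nat aexp aexp  \<comment> \<open>array, index, value\<close>
  | Seq com com
  | Cond bexp com com
  | Loop bexp com

inductive exec :: "com \<Rightarrow> state \<Rightarrow> nat \<Rightarrow> state \<Rightarrow> bool" where
  exec_Skip: "exec Skip s 1 s"
| exec_Assign: "exec (Assign a i e) s 1 (s(a := (s a)(aval i s := aval e s)))"
| exec_Seq: "exec c1 s t1 s' \<Longrightarrow> exec c2 s' t2 s'' \<Longrightarrow> exec (Seq c1 c2) s (t1 + t2) s''"
| exec_CondTrue: "bval b s \<Longrightarrow> exec c1 s t s' \<Longrightarrow> exec (Cond b c1 c2) s (1 + t) s'"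
| exec_CondFalse: "\<not> bval b s \<Longrightarrow> exec c2 s t s' \<Longrightarrow> exec (Cond b c1 c2) s (1 + t) s'"
| exec_LoopFalse: "\<not> bval b s \<Longrightarrow> exec (Loop b c) s 1 s"
| exec_LoopTrue: "bval b s \<Longrightarrow> exec c s t1 s' \<Longrightarrow> exec (Loop b c) s' t2 s'' \<Longrightarrow>
    exec (Loop b c) s (1 + t1 + t2) s''"

definition array_of :: "int list \<Rightarrow> int \<Rightarrow> int" where
  "array_of xs = (\<lambda>i. if 0 \<le> i \<and> i < int (length xs) then xs ! nat i else 0)"

definition initial_state :: "int list \<Rightarrow> state" where
  "initial_state xs = (\<lambda>a. if a = 0 then array_of xs else (\<lambda>_. 0))"

text \<open>The bit size of an input: each number is written in binary with one extra bit for the sign.\<close>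

definition bit_size :: "int list \<Rightarrow> nat" where
  "bit_size xs = (\<Sum>z\<leftarrow>xs. 1 + floorlog 2 (nat \<bar>z\<bar>))"

text \<open>
  The input is stored in array \<open>0\<close>, the output is read off array \<open>1\<close>. The length of the output
  is charged as well, since otherwise cells that were never written to would be output for free.
\<close>

definition polytime_computable ::
  "'a set \<Rightarrow> ('a \<Rightarrow> int list) \<Rightarrow> ('b \<Rightarrow> int list) \<Rightarrow> ('a \<Rightarrow> 'b) \<Rightarrow> bool" where
  "polytime_computable D enc_in enc_out f \<longleftrightarrow>
     (\<exists>(prog :: com) (q :: nat poly). \<forall>x \<in> D. \<exists>t s.
        exec prog (initial_state (enc_in x)) t s \<and>
        s 1 = array_of (enc_out (f x)) \<and>
        t + length (enc_out (f x)) \<le> poly q (bit_size (enc_in x)))"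

end

(* Let S consist of the vertices of a greedily built maximal matching of the complement graph. Then
   C = V - S is a clique, and |S| is at most twice the distance to clique, as every modulator meets
   every matching edge.

   If some vertex of C is happy, then C is monochromatic. The precoloured vertices in the closed
   neighbourhood of a vertex v of C decide for which colours of C the vertex v can be happy: for none,
   for exactly one colour, or for all. Colouring everything with the colour a that has the most
   supporters in C makes Q vertices happy, where Q counts these supporters and the vertices without a
   constraint, and no colouring makes more than Q + |S| vertices happy. So the answer is yes for
   thresholds k up to Q. For k > Q delete all unmarked vertices that are never happy, delete equally
   many unmarked vertices from each one-colour class (as far as it has them) and some from the
   unconstrained class, and lower k accordingly. The marks keep the instances equivalent:
   they witness common neighbours in C of pairs from S, they contain the extreme precolours in each
   neighbourhood, and they contain |S| neighbours of u in each class for each u in S (if these exist),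
   so that giving u the wrong colour costs more than all of S can gain. There are at most |S| + 3
   classes with O(|S|^2) remaining vertices each.

   All this is definable by terms with sums over the vertices, and every such term compiles to the
   random access machine with polynomial running time. *)
theory Submission imports Defs begin

section \<open>Compiling terms with bounded sums\<close>

text \<open>The colour of the clique in a solution is not known in advance, but the threshold can
  only be lowered by one number. This is why the surplus of every positive kind is computed from the
  largest positive class. A class with too few unmarked vertices to lose that many does no harm:
  with its colour on the clique, no solution of the reduced instance reaches the lowered threshold.

  The quantity \<open>slack\<close> bounds the marked vertices of one class, plus a reserve of |S|.
  The reserve pays for the happy vertices of S, at most |S| in number. Moreover, as soon as some
  surplus is positive, a solution of the reduced instance has at least \<open>slack\<close> > |S|
  happy vertices, so one of them lies in the clique and makes it monochromatic.

  The machine neither multiplies nor chooses. For this reason the construction is phrased with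
  ranks, least elements and counts, all of which are sums over the vertices.\<close>

text \<open>The sum ranges over the values below the number of vertices, which is the first input cell.
  So the running time of a term is polynomial by construction.\<close>

datatype tm =
    Num int
  | Var nat
  | Get nat tm
  | Add tm tm
  | Sub tm tm
  | Ite tm tm tm
  | Sum nat tm

primrec sem :: "tm \<Rightarrow> (nat \<Rightarrow> int \<Rightarrow> int) \<Rightarrow> (nat \<Rightarrow> int) \<Rightarrow> int" where
  "sem (Num z) A e = z"
| "sem (Var i) A e = e i"
| "sem (Get a t) A e = A a (sem t A e)"
| "sem (Add t u) A e = sem t A e + sem u A e"
| "sem (Sub t u) A e = sem t A e - sem u A e"
| "sem (Ite b t u) A e = (if 0 < sem b A e then sem t A e else sem u A e)"
| "sem (Sum i t) A e = (\<Sum>j<nat (A 0 0). sem t A (e(i := int j)))"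

text \<open>Machine arrays 2 and 3 hold the variables and the evaluation stack, machine array 1 is the output,
  which is computed as array 17 of the program.\<close>

definition arr :: "nat \<Rightarrow> nat" where
  "arr a = (if a = 0 then 0 else if a = 17 then 1 else a + 3)"

lemma arr_0 [simp]: "arr 0 = 0"
  and arr_neq [simp]: "arr a \<noteq> 2" "arr a \<noteq> 3"
  and arr_eq_iff [simp]: "arr a = arr b \<longleftrightarrow> a = b"
  by (auto simp: arr_def)

text \<open>A term compiled at depth \<open>d\<close> leaves its value in stack cell
  \<open>d\<close> and uses the cells above as scratch space. A sum accumulates in cell
  \<open>d\<close>, saves the old value of its variable in cell \<open>d + 1\<close> and evaluates
  its body at depth \<open>d + 2\<close>.\<close>

primrec compile :: "tm \<Rightarrow> nat \<Rightarrow> com" where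
  "compile (Num z) d = Assign 3 (Const (int d)) (Const z)"
| "compile (Var i) d = Assign 3 (Const (int d)) (Cell 2 (Const (int i)))"
| "compile (Get a t) d =
     Seq (compile t d) (Assign 3 (Const (int d)) (Cell (arr a) (Cell 3 (Const (int d)))))"
| "compile (Add t u) d =
     Seq (compile t d) (Seq (compile u (Suc d))
       (Assign 3 (Const (int d)) (Plus (Cell 3 (Const (int d))) (Cell 3 (Const (int (Suc d)))))))"
| "compile (Sub t u) d =
     Seq (compile t d) (Seq (compile u (Suc d))
       (Assign 3 (Const (int d)) (Minus (Cell 3 (Const (int d))) (Cell 3 (Const (int (Suc d)))))))"
| "compile (Ite b t u) d =
     Seq (compile b d) (Cond (Less (Const 0) (Cell 3 (Const (int d)))) (compile t d) (compile u d))"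
| "compile (Sum i t) d =
     Seq (Assign 3 (Const (int d)) (Const 0))
    (Seq (Assign 3 (Const (int (Suc d))) (Cell 2 (Const (int i))))
    (Seq (Assign 2 (Const (int i)) (Const 0))
    (Seq (Loop (Less (Cell 2 (Const (int i))) (Cell 0 (Const 0)))
           (Seq (compile t (Suc (Suc d)))
           (Seq (Assign 3 (Const (int d))
                  (Plus (Cell 3 (Const (int d))) (Cell 3 (Const (int (Suc (Suc d)))))))
                (Assign 2 (Const (int i)) (Plus (Cell 2 (Const (int i))) (Const 1))))))
         (Assign 2 (Const (int i)) (Cell 3 (Const (int (Suc d))))))))"

primrec cost :: "tm \<Rightarrow> nat poly" where
  "cost (Num z) = [:1:]"
| "cost (Var i) = [:1:]"
| "cost (Get a t) = cost t + [:1:]"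
| "cost (Add t u) = cost t + cost u + [:1:]"
| "cost (Sub t u) = cost t + cost u + [:1:]"
| "cost (Ite b t u) = cost b + cost t + cost u + [:1:]"
| "cost (Sum i t) = [:0, 1:] * (cost t + [:3:]) + [:5:]"

text \<open>Only the stack from depth \<open>d\<close> upwards may change. Array 2 is protected as
  well, so a sum has to restore its variable.\<close>

definition frame :: "nat \<Rightarrow> state \<Rightarrow> state \<Rightarrow> bool" where
  "frame d s s' \<longleftrightarrow> (\<forall>a. a \<noteq> 3 \<longrightarrow> s' a = s a) \<and> (\<forall>j < int d. s' 3 j = s 3 j)"

definition yields :: "com \<Rightarrow> state \<Rightarrow> nat \<Rightarrow> nat \<Rightarrow> int \<Rightarrow> bool" where
  "yields c s T d v \<longleftrightarrow>
     (\<exists>T' s'. exec c s T' s' \<and> T' \<le> T \<and> s' 3 (int d) = v \<and> frame d s s')"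

lemma exec_AssignI:
  "T = 1 \<Longrightarrow> s' = s(a := (s a)(aval i s := aval e s)) \<Longrightarrow> exec (Assign a i e) s T s'"
  using exec_Assign by simp

text \<open>Induction on the number \<open>m\<close> of remaining rounds, because
  \<open>exec_LoopTrue\<close> splits off the first one. Every round adds 1 for its test, and the
  final 1 is the failing test.\<close>

lemma exec_loop_iterate:
  assumes step: "\<And>j s. j < n \<Longrightarrow> P j s \<Longrightarrow> bval b s \<and> (\<exists>T s'. exec c s T s' \<and> T \<le> t \<and> P (Suc j) s')"
    and stop: "\<And>s. P n s \<Longrightarrow> \<not> bval b s"
    and "P 0 s"
  shows "\<exists>T s'. exec (Loop b c) s T s' \<and> T \<le> n * (t + 1) + 1 \<and> P n s'"
proof -
  have "\<exists>T s'. exec (Loop b c) s T s' \<and> T \<le> m * (t + 1) + 1 \<and> P n s'"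
    if "m \<le> n" "P (n - m) s" for m s
    using that
  proof (induction m arbitrary: s)
    case 0
    then show ?case using stop[of s] exec_LoopFalse by fastforce
  next
    case (Suc m)
    obtain T s' where 1: "bval b s" "exec c s T s'" "T \<le> t" "P (Suc (n - Suc m)) s'"
      using step[of "n - Suc m" s] Suc.prems by auto
    have "Suc (n - Suc m) = n - m" using Suc.prems by simp
    then obtain T' s'' where 2: "exec (Loop b c) s' T' s''" "T' \<le> m * (t + 1) + 1" "P n s''"
      using Suc.IH[of s'] Suc.prems 1 by auto
    show ?case
      using exec_LoopTrue[OF 1(1,2) 2(1)] 1(3) 2(2,3) by fastforce
  qed
  from this[of n s] show ?thesis using assms(3) by simp
qed

abbreviation view :: "state \<Rightarrow> nat \<Rightarrow> int \<Rightarrow> int" where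
  "view s \<equiv> (\<lambda>a. s (arr a))"

abbreviation env :: "state \<Rightarrow> nat \<Rightarrow> int" where
  "env s \<equiv> (\<lambda>i. s 2 (int i))"

lemma frame_view: "frame d s s' \<Longrightarrow> view s' = view s"
  and frame_env: "frame d s s' \<Longrightarrow> env s' = env s"
  and frame_0: "frame d s s' \<Longrightarrow> s' 0 = s 0"
  by (auto simp: frame_def)

lemma yields_binary:
  assumes t: "yields c s T1 d v" and u: "\<And>s'. frame d s s' \<Longrightarrow> yields c' s' T2 (Suc d) w"
    and ae: "\<And>s. aval e s = f (s 3 (int d)) (s 3 (int (Suc d)))"
  shows "yields (Seq c (Seq c' (Assign 3 (Const (int d)) e))) s (T1 + T2 + 1) d (f v w)"
proof -
  obtain Ta sa where a: "exec c s Ta sa" "Ta \<le> T1" "sa 3 (int d) = v" "frame d s sa"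
    using t by (auto simp: yields_def)
  obtain Tb sb where b: "exec c' sa Tb sb" "Tb \<le> T2" "sb 3 (int (Suc d)) = w" "frame (Suc d) sa sb"
    using u[OF a(4)] by (auto simp: yields_def)
  have "sb 3 (int d) = v" using a(3) b(4) by (auto simp: frame_def)
  have "frame d s (sb(3 := (sb 3)(int d := f v w)))"
    using a(4) b(4) by (auto simp: frame_def)
  then show ?thesis
    unfolding yields_def
    using a(2) b(2,3) \<open>sb 3 (int d) = v\<close>
    by (intro exI[of _ "Ta + (Tb + 1)"] exI[of _ "sb(3 := (sb 3)(int d := f v w))"] conjI
        exec_Seq[OF a(1)] exec_Seq[OF b(1)] exec_AssignI) (auto simp: ae simp del: of_nat_Suc)
qed

text \<open>Induction on the term for arbitrary depths and states. The time bound depends on the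
  state only through cell 0 of array 0, which no evaluation changes, so the bounds of subterms add
  up.\<close>

lemma compile_correct: "yields (compile t d) s (poly (cost t) (nat (s 0 0))) d (sem t (view s) (env s))"
proof (induction t arbitrary: d s)
  case (Num z)
  show ?case unfolding yields_def
    by (intro exI[of _ 1] exI conjI, simp, rule exec_Assign) (auto simp: frame_def)
next
  case (Var i)
  show ?case unfolding yields_def
    by (intro exI[of _ 1] exI conjI, simp, rule exec_Assign) (auto simp: frame_def)
next
  case (Get a t)
  obtain T s' where 1: "exec (compile t d) s T s'" "T \<le> poly (cost t) (nat (s 0 0))"
     "s' 3 (int d) = sem t (view s) (env s)" "frame d s s'"
    using Get.IH[of d s] by (auto simp: yields_def)
  let ?s = "s'(3 := (s' 3)(int d := sem (Get a t) (view s) (env s)))"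
  have "frame d s ?s" using 1(4) by (auto simp: frame_def)
  moreover have "exec (compile (Get a t) d) s (T + 1) ?s"
    unfolding compile.simps
    by (rule exec_Seq[OF 1(1)], rule exec_AssignI) (use 1(3,4) in \<open>auto simp: frame_def\<close>)
  ultimately show ?case
    unfolding yields_def using 1(2) by (intro exI[of _ "T + 1"] exI[of _ ?s]) auto
next
  case (Add t u)
  have "yields (compile u (Suc d)) s' (poly (cost u) (nat (s 0 0))) (Suc d) (sem u (view s) (env s))"
    if "frame d s s'" for s'
    using Add.IH(2)[of "Suc d" s'] that by (simp only: frame_0 frame_view frame_env)
  from yields_binary[OF Add.IH(1) this, where e = "Plus (Cell 3 (Const (int d))) (Cell 3 (Const (int (Suc d))))" and f = "(+)"]
  show ?case by simp
next
  case (Sub t u)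
  have "yields (compile u (Suc d)) s' (poly (cost u) (nat (s 0 0))) (Suc d) (sem u (view s) (env s))"
    if "frame d s s'" for s'
    using Sub.IH(2)[of "Suc d" s'] that by (simp only: frame_0 frame_view frame_env)
  from yields_binary[OF Sub.IH(1) this, where e = "Minus (Cell 3 (Const (int d))) (Cell 3 (Const (int (Suc d))))" and f = "(-)"]
  show ?case by simp
next
  case (Ite b t u)
  obtain T s' where 1: "exec (compile b d) s T s'" "T \<le> poly (cost b) (nat (s 0 0))"
     "s' 3 (int d) = sem b (view s) (env s)" "frame d s s'"
    using Ite.IH(1)[of d s] by (auto simp: yields_def)
  note fr = frame_0[OF 1(4)] frame_view[OF 1(4)] frame_env[OF 1(4)]
  have tr: "frame d s s''" if "frame d s' s''" for s''
    using that 1(4) by (auto simp: frame_def)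
  show ?case
  proof (cases "0 < sem b (view s) (env s)")
    case True
    obtain T2 s2 where 2: "exec (compile t d) s' T2 s2" "T2 \<le> poly (cost t) (nat (s 0 0))"
     "s2 3 (int d) = sem t (view s) (env s)" "frame d s' s2"
      using Ite.IH(2)[of d s'] unfolding fr by (auto simp: yields_def)
    have "exec (compile (Ite b t u) d) s (T + (1 + T2)) s2"
      unfolding compile.simps
      by (rule exec_Seq[OF 1(1)], rule exec_CondTrue[OF _ 2(1)]) (use True 1(3) in simp)
    then show ?thesis unfolding yields_def using True 1 2 tr[of s2] by fastforce
  next
    case False
    obtain T2 s2 where 2: "exec (compile u d) s' T2 s2" "T2 \<le> poly (cost u) (nat (s 0 0))"
     "s2 3 (int d) = sem u (view s) (env s)" "frame d s' s2"
      using Ite.IH(3)[of d s'] unfolding fr by (auto simp: yields_def)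
    have "exec (compile (Ite b t u) d) s (T + (1 + T2)) s2"
      unfolding compile.simps
      by (rule exec_Seq[OF 1(1)], rule exec_CondFalse[OF _ 2(1)]) (use False 1(3) in simp)
    then show ?thesis unfolding yields_def using False 1 2 tr[of s2] by fastforce
  qed
next
  case (Sum i t)
  define n where "n = nat (s 0 0)"
  define F where "F j = sem t (view s) ((env s)(i := int j))" for j :: nat
  define b where "b = Less (Cell 2 (Const (int i))) (Cell 0 (Const 0))"
  define c where "c = Seq (compile t (Suc (Suc d)))
           (Seq (Assign 3 (Const (int d))
                  (Plus (Cell 3 (Const (int d))) (Cell 3 (Const (int (Suc (Suc d)))))))
                (Assign 2 (Const (int i)) (Plus (Cell 2 (Const (int i))) (Const 1))))"
  define P where "P j s' \<longleftrightarrow> s' 2 = (s 2)(int i := int j) \<and> (\<forall>a. a \<noteq> 2 \<and> a \<noteq> 3 \<longrightarrow> s' a = s a)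
      \<and> (\<forall>j < int d. s' 3 j = s 3 j) \<and> s' 3 (int d) = (\<Sum>k<j. F k)
      \<and> s' 3 (int (Suc d)) = s 2 (int i)" for j s'
  define sa where "sa = s(3 := (s 3)(int d := 0))"
  define sb where "sb = sa(3 := (sa 3)(int (Suc d) := s 2 (int i)))"
  define s0 where "s0 = sb(2 := (sb 2)(int i := 0))"
  have P0: "P 0 s0" by (auto simp: P_def s0_def sb_def sa_def)
  have loop: "\<exists>T s'. exec (Loop b c) s0 T s' \<and> T \<le> n * ((poly (cost t) n + 2) + 1) + 1 \<and> P n s'"
  proof (rule exec_loop_iterate[of _ P, OF _ _ P0])
    fix j s' assume j: "j < n" and P: "P j s'"
    have ev: "env s' = (env s)(i := int j)" "view s' = view s" "s' 0 = s 0"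
      using P by (auto simp: P_def)
    obtain T s2 where 1: "exec (compile t (Suc (Suc d))) s' T s2" "T \<le> poly (cost t) n"
     "s2 3 (int (Suc (Suc d))) = F j" "frame (Suc (Suc d)) s' s2"
      using Sum.IH[of "Suc (Suc d)" s'] unfolding ev by (auto simp: yields_def F_def n_def)
    define s3 where "s3 = s2(3 := (s2 3)(int d := (\<Sum>k<Suc j. F k)))"
    define s4 where "s4 = s3(2 := (s3 2)(int i := int (Suc j)))"
    have *: "s2 2 = s' 2" "s2 3 (int d) = s' 3 (int d)"
      using 1(4) by (auto simp: frame_def)
    have "exec c s' (T + (1 + 1)) s4"
      unfolding c_def
      by (rule exec_Seq[OF 1(1)], rule exec_Seq[of _ _ _ s3]; rule exec_AssignI)
         (use * P 1(3) in \<open>auto simp: s3_def s4_def P_def add.commute\<close>)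
    moreover have "P (Suc j) s4"
      using P 1(4) by (auto simp: P_def s4_def s3_def frame_def)
    moreover have "bval b s'" using j P by (auto simp: b_def P_def n_def)
    ultimately show "bval b s' \<and> (\<exists>T s''. exec c s' T s'' \<and> T \<le> poly (cost t) n + 2 \<and> P (Suc j) s'')"
      using 1(2) by (intro conjI exI[of _ "T + (1 + 1)"] exI[of _ s4]) auto
  next
    fix s' assume "P n s'"
    then show "\<not> bval b s'" by (auto simp: b_def P_def n_def)
  qed
  then obtain T s' where 1: "exec (Loop b c) s0 T s'" "T \<le> n * ((poly (cost t) n + 2) + 1) + 1" "P n s'"
    by blast
  define s1 where "s1 = s'(2 := (s' 2)(int i := s 2 (int i)))"
  have "exec (compile (Sum i t) d) s (1 + (1 + (1 + (T + 1)))) s1"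
    unfolding compile.simps b_def[symmetric] c_def[symmetric]
    by (rule exec_Seq[of _ _ _ sa], rule exec_AssignI, simp, simp add: sa_def,
        rule exec_Seq[of _ _ _ sb], rule exec_AssignI, simp, simp add: sb_def sa_def,
        rule exec_Seq[of _ _ _ s0], rule exec_AssignI, simp, simp add: s0_def,
        rule exec_Seq[OF 1(1)], rule exec_AssignI, simp)
       (use 1(3) in \<open>simp add: s1_def P_def\<close>)
  moreover have "frame d s s1" using 1(3) by (auto simp: frame_def s1_def P_def)
  moreover have "s1 3 (int d) = (\<Sum>k<n. F k)" using 1(3) by (auto simp: s1_def P_def)
  ultimately show ?case
    unfolding yields_def using 1(2)
    by (intro exI[of _ "1 + (1 + (1 + (T + 1)))"] exI[of _ s1]) (auto simp: F_def n_def algebra_simps)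
qed

section \<open>Computing one array after another, uniformly in polynomial time\<close>

definition look :: "(int \<Rightarrow> int) list \<Rightarrow> nat \<Rightarrow> int \<Rightarrow> int" where
  "look xs a = (if a < length xs then xs ! a else (\<lambda>_. 0))"

text \<open>Cells outside the range read as 0, like cells that were never written. Hence
  \<open>tab j f\<close> describes a table of which only the first \<open>j\<close> entries have
  been filled in.\<close>

definition tab :: "nat \<Rightarrow> (nat \<Rightarrow> int) \<Rightarrow> int \<Rightarrow> int" where
  "tab m f = (\<lambda>i. if 0 \<le> i \<and> i < int m then f (nat i) else 0)"

lemma tab_of_nat [simp]: "tab m f (int v) = (if v < m then f v else 0)"
  by (simp add: tab_def)

lemma tab_0 [simp]: "tab 0 f = (\<lambda>_. 0)"
  by (auto simp: tab_def)

lemma tab_Suc: "tab (Suc m) f = (tab m f)(int m := f m)"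
  by (auto simp: tab_def fun_eq_iff)

lemma look_append_upd:
  "look (xs @ [g(i := v)]) = (look (xs @ [g]))(length xs := (g(i := v)))"
  by (auto simp: look_def fun_eq_iff nth_append)

text \<open>Program and time bound are fixed before the input is. The assumption on the state
  concerns only the arrays that terms can see; stack and variables may hold leftovers, which makes
  such computations composable.\<close>

definition reach :: "'a set \<Rightarrow> ('a \<Rightarrow> nat) \<Rightarrow> ('a \<Rightarrow> (int \<Rightarrow> int) list) \<Rightarrow> ('a \<Rightarrow> (int \<Rightarrow> int) list) \<Rightarrow> bool" where
  "reach D n xs ys \<longleftrightarrow>
     (\<exists>c q. \<forall>x\<in>D. \<forall>s. view s = look (xs x) \<longrightarrow>
        (\<exists>T s'. exec c s T s' \<and> T \<le> poly q (n x) \<and> view s' = look (ys x)))"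

lemma reach_trans:
  assumes "reach D n xs ys" "reach D n ys zs"
  shows "reach D n xs zs"
proof -
  obtain c q where 1: "\<And>x s. x \<in> D \<Longrightarrow> view s = look (xs x) \<Longrightarrow>
        (\<exists>T s'. exec c s T s' \<and> T \<le> poly q (n x) \<and> view s' = look (ys x))"
    using assms(1) unfolding reach_def by blast
  obtain c' q' where 2: "\<And>x s. x \<in> D \<Longrightarrow> view s = look (ys x) \<Longrightarrow>
        (\<exists>T s'. exec c' s T s' \<and> T \<le> poly q' (n x) \<and> view s' = look (zs x))"
    using assms(2) unfolding reach_def by blast
  show ?thesis
    unfolding reach_def
  proof (intro exI[of _ "Seq c c'"] exI[of _ "q + q'"] ballI allI impI)
    fix x s assume x: "x \<in> D" "view s = look (xs x)"
    obtain T s' where a: "exec c s T s'" "T \<le> poly q (n x)" "view s' = look (ys x)"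
      using 1[OF x] by blast
    obtain T' s'' where b: "exec c' s' T' s''" "T' \<le> poly q' (n x)" "view s'' = look (zs x)"
      using 2[OF x(1) a(3)] by blast
    show "\<exists>T s'. exec (Seq c c') s T s' \<and> T \<le> poly (q + q') (n x) \<and> view s' = look (zs x)"
      using exec_Seq[OF a(1) b(1)] a(2) b(2,3) by (intro exI[of _ "T + T'"] exI[of _ s'']) auto
  qed
qed

text \<open>The term may refer to the entries of the new array that have already been computed.\<close>

lemma reach_append:
  assumes len: "\<And>x. x \<in> D \<Longrightarrow> length (xs x) = L" and L: "L \<noteq> 0"
    and n: "\<And>x. x \<in> D \<Longrightarrow> look (xs x) 0 0 = int (n x)"
    and b: "\<And>x e. x \<in> D \<Longrightarrow> sem b (look (xs x)) e = int (B x)"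
    and B: "\<And>x. x \<in> D \<Longrightarrow> B x \<le> poly qb (n x)"
    and t: "\<And>x j e. x \<in> D \<Longrightarrow> j < B x \<Longrightarrow> sem t (look (xs x @ [tab j (f x)])) (e(0 := int j)) = f x j"
  shows "reach D n xs (\<lambda>x. xs x @ [tab (B x) (f x)])"
proof -
  \<comment> \<open>The number of rounds stays in stack cell 0 during the loop; this is why
    \<open>t\<close> is compiled at depth 1.\<close>
  define be where "be = Less (Cell 2 (Const 0)) (Cell 3 (Const 0))"
  define c where "c = Seq (compile t 1) (Seq (Assign (arr L) (Cell 2 (Const 0)) (Cell 3 (Const 1)))
       (Assign 2 (Const 0) (Plus (Cell 2 (Const 0)) (Const 1))))"
  define prog where "prog = Seq (compile b 0) (Seq (Assign 2 (Const 0) (Const 0)) (Loop be c))"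
  define q where "q = cost b + (qb * (cost t + [:3:]) + [:2:])"
  show ?thesis
    unfolding reach_def
  proof (intro exI[of _ prog] exI[of _ q] ballI allI impI)
    fix x s assume x: "x \<in> D" and s: "view s = look (xs x)"
    have L0: "look (xs x @ [tab 0 (f x)]) = look (xs x)"
      by (auto simp: look_def nth_append fun_eq_iff)
    have s0: "s 0 0 = int (n x)" using n[OF x] fun_cong[OF fun_cong[OF s], of 0 0] by simp
    obtain T0 s1 where 1: "exec (compile b 0) s T0 s1" "T0 \<le> poly (cost b) (n x)"
      "s1 3 0 = int (B x)" "frame 0 s s1"
      using compile_correct[of b 0 s] b[OF x] unfolding yields_def s s0 by auto
    define P where "P j s' \<longleftrightarrow> s' 2 0 = int j \<and> s' 3 0 = int (B x) \<and>
        view s' = look (xs x @ [tab j (f x)])" for j s'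
    define s2 where "s2 = s1(2 := (s1 2)(0 := 0))"
    have "view s2 = view s1" by (auto simp: s2_def)
    then have "P 0 s2" using 1(3,4) L0 by (auto simp: P_def s2_def frame_view s)
    have "\<exists>T s'. exec (Loop be c) s2 T s' \<and> T \<le> B x * ((poly (cost t) (n x) + 2) + 1) + 1 \<and> P (B x) s'"
    proof (rule exec_loop_iterate[of _ P, OF _ _ \<open>P 0 s2\<close>])
      fix j s' assume j: "j < B x" and P: "P j s'"
      have v: "view s' = look (xs x @ [tab j (f x)])" using P by (simp add: P_def)
      have n': "s' 0 0 = int (n x)"
        using fun_cong[OF fun_cong[OF v], of 0 0] n[OF x] len[OF x] L
        by (simp add: look_def nth_append split: if_splits)
      have e: "env s' = (env s')(0 := int j)" using P by (auto simp: P_def fun_eq_iff)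
      have st: "sem t (view s') (env s') = f x j"
        unfolding v by (subst e) (rule t[OF x j])
      obtain T s3 where 3: "exec (compile t 1) s' T s3" "T \<le> poly (cost t) (n x)"
        "s3 3 1 = f x j" "frame 1 s' s3"
        using compile_correct[of t 1 s'] unfolding yields_def n' st by auto
      define s4 where "s4 = s3(arr L := (s3 (arr L))(int j := f x j))"
      define s5 where "s5 = s4(2 := (s4 2)(0 := int (Suc j)))"
      have fr: "s3 2 0 = int j" "s3 3 0 = int (B x)" using P 3(4) by (auto simp: P_def frame_def)
      have neq: "2 \<noteq> arr L" "3 \<noteq> arr L" using arr_neq by metis+
      have s4: "s4 2 0 = int j" "s4 3 0 = int (B x)" using fr neq by (auto simp: s4_def)
      have "exec c s' (T + (1 + 1)) s5"
        unfolding c_def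
        by (rule exec_Seq[OF 3(1)], rule exec_Seq[of _ _ _ s4], rule exec_AssignI, simp,
            use fr 3(3) in \<open>simp add: s4_def\<close>, rule exec_AssignI, simp)
           (use s4 in \<open>simp add: s5_def add.commute\<close>)
      moreover have "view s5 = look (xs x @ [tab (Suc j) (f x)])"
      proof -
        have v3: "view s3 = look (xs x @ [tab j (f x)])" using 3(4) v by (simp add: frame_view)
        have "view s5 = (view s3)(L := (view s3 L)(int j := f x j))"
          by (auto simp: s5_def s4_def fun_eq_iff)
        also have "view s3 L = tab j (f x)"
          using fun_cong[OF v3, of L] len[OF x] by (simp add: look_def nth_append)
        finally show ?thesis
          unfolding v3 tab_Suc look_append_upd len[OF x] .
      qed
      then have "P (Suc j) s5" using s4 by (simp add: P_def s5_def)
      moreover have "bval be s'" using j P by (simp add: be_def P_def)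
      ultimately show "bval be s' \<and>
          (\<exists>T s''. exec c s' T s'' \<and> T \<le> poly (cost t) (n x) + 2 \<and> P (Suc j) s'')"
        using 3(2) by (intro conjI exI[of _ "T + (1 + 1)"] exI[of _ s5]) auto
    next
      fix s' assume "P (B x) s'"
      then show "\<not> bval be s'" by (simp add: be_def P_def)
    qed
    then obtain T s' where 2: "exec (Loop be c) s2 T s'" "P (B x) s'"
      "T \<le> B x * ((poly (cost t) (n x) + 2) + 1) + 1" by blast
    have "exec prog s (T0 + (1 + T)) s'"
      unfolding prog_def
      by (rule exec_Seq[OF 1(1)], rule exec_Seq[OF _ 2(1)], rule exec_AssignI, simp)
         (simp add: s2_def)
    moreover have "B x * ((poly (cost t) (n x) + 2) + 1) \<le> poly qb (n x) * (poly (cost t) (n x) + 3)"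
      using mult_le_mono1[OF B[OF x], of "poly (cost t) (n x) + 3"] by (simp add: algebra_simps)
    then have "T0 + (1 + T) \<le> poly q (n x)"
      using 1(2) 2(3) by (simp add: q_def)
    ultimately show "\<exists>T s'. exec prog s T s' \<and> T \<le> poly q (n x) \<and> view s' = look (xs x @ [tab (B x) (f x)])"
      using 2(2) unfolding P_def by blast
  qed
qed

lemma poly_nat_mono: "m \<le> n \<Longrightarrow> poly q m \<le> poly q n" for q :: "nat poly"
  by (induction q) (auto intro!: add_mono mult_mono)

lemma bit_size_ge_length: "length xs \<le> bit_size xs"
  unfolding bit_size_def by (induction xs) auto

text \<open>Bounds may be given in terms of \<open>n x\<close> instead of the bit size: every number
  of the input takes at least one bit, and polynomials over the naturals are monotone.\<close>

lemma polytime_computableI: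
  assumes reach: "reach D n (\<lambda>x. [array_of (enc x)]) ys"
    and n: "\<And>x. x \<in> D \<Longrightarrow> n x \<le> length (enc x)"
    and out: "\<And>x. x \<in> D \<Longrightarrow> look (ys x) 17 = array_of (enc' (f x))"
    and len: "\<And>x. x \<in> D \<Longrightarrow> length (enc' (f x)) \<le> poly q (n x)"
  shows "polytime_computable D enc enc' f"
proof -
  obtain c r where c: "\<And>x s. x \<in> D \<Longrightarrow> view s = look [array_of (enc x)] \<Longrightarrow>
        (\<exists>T s'. exec c s T s' \<and> T \<le> poly r (n x) \<and> view s' = look (ys x))"
    using reach unfolding reach_def by blast
  show ?thesis
    unfolding polytime_computable_def
  proof (intro exI[of _ c] exI[of _ "r + q"] ballI)
    fix x assume x: "x \<in> D"
    have "view (initial_state (enc x)) = look [array_of (enc x)]"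
      by (auto simp: initial_state_def look_def arr_def fun_eq_iff)
    from c[OF x this] obtain T s' where
      1: "exec c (initial_state (enc x)) T s'" "T \<le> poly r (n x)" "view s' = look (ys x)" by blast
    have "s' 1 = array_of (enc' (f x))"
      using fun_cong[OF 1(3), of 17] out[OF x] by (simp add: arr_def)
    moreover have "n x \<le> bit_size (enc x)" using n[OF x] bit_size_ge_length[of "enc x"] by simp
    then have "T + length (enc' (f x)) \<le> poly (r + q) (bit_size (enc x))"
      using 1(2) len[OF x] poly_nat_mono[of "n x" "bit_size (enc x)" r]
        poly_nat_mono[of "n x" "bit_size (enc x)" q] by simp
    ultimately show "\<exists>t s. exec c (initial_state (enc x)) t s \<and> s 1 = array_of (enc' (f x)) \<and>
        t + length (enc' (f x)) \<le> poly (r + q) (bit_size (enc x))" using 1(1) by blast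
  qed
qed

text \<open>Terms double as formulas; a formula holds if its value is positive.\<close>

definition holds :: "tm \<Rightarrow> (nat \<Rightarrow> int \<Rightarrow> int) \<Rightarrow> (nat \<Rightarrow> int) \<Rightarrow> bool" where
  "holds t A e \<longleftrightarrow> 0 < sem t A e"

definition TLt where "TLt a b = Sub b a"
definition TNot where "TNot a = Ite a (Num 0) (Num 1)"
definition TAnd where "TAnd a b = Ite a b (Num 0)"
definition TOr where "TOr a b = Ite a (Num 1) b"
definition TEq where "TEq a b = TAnd (TNot (TLt a b)) (TNot (TLt b a))"
definition TCard where "TCard i a = Sum i (Ite a (Num 1) (Num 0))"
definition TBool where "TBool a = Ite a (Num 1) (Num 0)"

lemma holds_simps [simp]:
  "holds (TLt a b) A e \<longleftrightarrow> sem a A e < sem b A e"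
  "holds (TNot a) A e \<longleftrightarrow> \<not> holds a A e"
  "holds (TAnd a b) A e \<longleftrightarrow> holds a A e \<and> holds b A e"
  "holds (TOr a b) A e \<longleftrightarrow> holds a A e \<or> holds b A e"
  "holds (TEq a b) A e \<longleftrightarrow> sem a A e = sem b A e"
  "holds (Get r a) A e \<longleftrightarrow> 0 < A r (sem a A e)"
  by (auto simp: holds_def TLt_def TNot_def TAnd_def TOr_def TEq_def)

lemma sem_Ite: "sem (Ite b t u) A e = (if holds b A e then sem t A e else sem u A e)"
  by (simp add: holds_def)

lemma sem_TBool [simp]: "sem (TBool a) A e = of_bool (holds a A e)"
  by (simp add: holds_def TBool_def)

lemma sem_TCard [simp]:
  "sem (TCard i a) A e = int (card {j. j < nat (A 0 0) \<and> holds a A (e(i := int j))})"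
proof -
  have "sem (TCard i a) A e = (\<Sum>j<nat (A 0 0). if holds a A (e(i := int j)) then 1 else 0)"
    unfolding TCard_def sem.simps holds_def ..
  also have "\<dots> = int (card ({..<nat (A 0 0)} \<inter> {j. holds a A (e(i := int j))}))"
    by (subst sum.If_cases) auto
  finally show ?thesis by (simp add: lessThan_def Collect_conj_eq)
qed

text \<open>Read as a formula, a count is an existential quantifier over the vertices.\<close>

lemma holds_TCard [simp]:
  "holds (TCard i a) A e \<longleftrightarrow> (\<exists>j<nat (A 0 0). holds a A (e(i := int j)))"
proof -
  have "finite {j. j < nat (A 0 0) \<and> holds a A (e(i := int j))}" by simp
  then show ?thesis unfolding holds_def[of "TCard i a"] sem_TCard
    by (auto simp: card_gt_0_iff simp del: sem_TCard)
qed

section \<open>Induced subinstances\<close>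

definition adj :: "'a mhv \<Rightarrow> 'a \<Rightarrow> 'a \<Rightarrow> bool" where
  "adj I u v \<longleftrightarrow> {u, v} \<in> edges (graph I)"

text \<open>Colours start at 1, so 0 can stand for the absence of a precolour, as in the encoding of
  instances.\<close>

definition pcol :: "'a mhv \<Rightarrow> 'a \<Rightarrow> nat" where
  "pcol I v = (case precoloring I v of None \<Rightarrow> 0 | Some a \<Rightarrow> a)"

definition happy_in :: "'a mhv \<Rightarrow> 'a set \<Rightarrow> ('a \<Rightarrow> nat) \<Rightarrow> 'a set" where
  "happy_in I R c = {v \<in> R. \<forall>u\<in>R. adj I u v \<longrightarrow> c u = c v}"

definition valid_on :: "'a mhv \<Rightarrow> 'a set \<Rightarrow> ('a \<Rightarrow> nat) \<Rightarrow> bool" where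
  "valid_on I R c \<longleftrightarrow>
     (\<forall>v\<in>R. c v \<in> {1..num_colors I} \<and> (pcol I v \<noteq> 0 \<longrightarrow> c v = pcol I v))"

text \<open>Induced subinstances keep the vertex names of \<open>I\<close> here, which frees the
  equivalence proof for the kernel from any renumbering.\<close>

definition solvable :: "'a mhv \<Rightarrow> 'a set \<Rightarrow> int \<Rightarrow> bool" where
  "solvable I R k \<longleftrightarrow> (\<exists>c. valid_on I R c \<and> k \<le> int (card (happy_in I R c)))"

lemma adj_sym: "adj I u v \<longleftrightarrow> adj I v u"
  by (simp add: adj_def insert_commute)

lemma adj_verts: "wf_mhv I \<Longrightarrow> adj I u v \<Longrightarrow> u \<in> verts (graph I) \<and> v \<in> verts (graph I)"
  unfolding adj_def wf_mhv_def simple_graph_def by blast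

lemma pcol_le: "wf_mhv I \<Longrightarrow> pcol I v \<le> num_colors I"
  by (auto simp: pcol_def wf_mhv_def ran_def split: option.split)

lemma mhv_yes_iff_solvable:
  assumes wf: "wf_mhv I"
  shows "mhv_yes I \<longleftrightarrow> solvable I (verts (graph I)) (threshold I)"
proof -
  let ?V = "verts (graph I)"
  have "v \<in> ?V \<and> a \<in> {1..num_colors I}" if "precoloring I v = Some a" for v a
    using wf that by (auto simp: wf_mhv_def intro!: ranI)
  then have valid: "c \<in> ?V \<rightarrow> {1..num_colors I} \<and> extends c (precoloring I) \<longleftrightarrow> valid_on I ?V c" for c
    by (fastforce simp: extends_def valid_on_def pcol_def Pi_iff split: option.splits)
  have happy: "{v \<in> ?V. happy (graph I) c v} = happy_in I ?V c" for c
    using adj_verts[OF wf] by (auto simp: happy_in_def happy_def adj_def)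
  have "mhv_yes I \<longleftrightarrow> (\<exists>c. (c \<in> ?V \<rightarrow> {1..num_colors I} \<and> extends c (precoloring I)) \<and>
      threshold I \<le> int (card {v \<in> ?V. happy (graph I) c v}))"
    unfolding mhv_yes_def by blast
  then show ?thesis unfolding valid happy solvable_def .
qed

text \<open>A coloring of the image is pulled back along \<open>g\<close>. Applied to the
  renumbering and to its inverse, this gives both directions for a renumbered instance.\<close>

lemma solvable_image:
  assumes inj: "inj_on g R"
    and adj: "\<And>x y. x \<in> R \<Longrightarrow> y \<in> R \<Longrightarrow> adj J (g x) (g y) \<longleftrightarrow> adj I x y"
    and pcol: "\<And>x. x \<in> R \<Longrightarrow> pcol J (g x) = pcol I x"
    and num: "num_colors J = num_colors I"
    and sol: "solvable J (g ` R) k"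
  shows "solvable I R k"
proof -
  obtain c where c: "valid_on J (g ` R) c" "k \<le> int (card (happy_in J (g ` R) c))"
    using sol by (auto simp: solvable_def)
  have "happy_in J (g ` R) c = g ` happy_in I R (c \<circ> g)"
    using adj by (auto simp: happy_in_def)
  moreover have "inj_on g (happy_in I R (c \<circ> g))"
    by (rule inj_on_subset[OF inj]) (auto simp: happy_in_def)
  ultimately have "k \<le> int (card (happy_in I R (c \<circ> g)))"
    using c(2) by (simp add: card_image)
  moreover have "valid_on I R (c \<circ> g)"
    using c(1) pcol num by (auto simp: valid_on_def)
  ultimately show ?thesis by (auto simp: solvable_def)
qed

section \<open>Renumbering a vertex set by ranks\<close>

definition rk :: "nat set \<Rightarrow> nat \<Rightarrow> nat" where
  "rk R x = card {y \<in> R. y < x}"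

lemma rk_less: "finite R \<Longrightarrow> x \<in> R \<Longrightarrow> x < y \<Longrightarrow> rk R x < rk R y"
  unfolding rk_def by (rule psubset_card_mono) auto

lemma inj_on_rk: "finite R \<Longrightarrow> inj_on (rk R) R"
  by (metis inj_onI less_irrefl linorder_neqE_nat rk_less)

lemma rk_less_card: "finite R \<Longrightarrow> x \<in> R \<Longrightarrow> rk R x < card R"
  unfolding rk_def by (rule psubset_card_mono) auto

lemma rk_image: "finite R \<Longrightarrow> rk R ` R = {..<card R}"
  by (rule card_subset_eq) (auto simp: rk_less_card card_image[OF inj_on_rk])

text \<open>Ranks fill an initial segment bijectively, so a bound on the rank selects a prescribed
  number of vertices without any choice. The degree marks and the deleted vertices are picked in
  this way.\<close>

lemma card_rk_less:
  assumes "finite R"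
  shows "card {x \<in> R. rk R x < m} = min m (card R)"
proof -
  have "rk R ` {x \<in> R. rk R x < m} = rk R ` R \<inter> {..<m}" by auto
  also have "\<dots> = {..<min m (card R)}" unfolding rk_image[OF assms] by auto
  finally have "rk R ` {x \<in> R. rk R x < m} = {..<min m (card R)}" .
  moreover have "inj_on (rk R) {x \<in> R. rk R x < m}"
    by (rule inj_on_subset[OF inj_on_rk[OF assms]]) auto
  ultimately show ?thesis by (metis card_image card_lessThan)
qed

definition subinstance :: "nat mhv \<Rightarrow> nat set \<Rightarrow> int \<Rightarrow> nat mhv" where
  "subinstance I R k =
     \<lparr>graph = \<lparr>verts = {..<card R}, edges = (`) (rk R) ` {e \<in> edges (graph I). e \<subseteq> R}\<rparr>,
      num_colors = num_colors I,
      precoloring = (\<lambda>i. if i < card R then precoloring I (inv_into R (rk R) i) else None),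
      threshold = k\<rparr>"

lemma subinstance_simps [simp]:
  "verts (graph (subinstance I R k)) = {..<card R}"
  "num_colors (subinstance I R k) = num_colors I"
  "threshold (subinstance I R k) = k"
  by (simp_all add: subinstance_def)

context
  fixes I :: "nat mhv" and R :: "nat set"
  assumes wf: "wf_mhv I" and R: "R \<subseteq> verts (graph I)"
begin

lemma finite_subset_verts: "finite R"
  using wf R by (auto simp: wf_mhv_def simple_graph_def intro: finite_subset)

lemma subinstance_instance: "subinstance I R k \<in> mhv_instances"
proof -
  have inj: "inj_on (rk R) R" and im: "rk R ` R = {..<card R}"
    using finite_subset_verts by (simp_all add: inj_on_rk rk_image)
  have "rk R ` e \<subseteq> {..<card R}" "card (rk R ` e) = 2" if "e \<in> edges (graph I)" "e \<subseteq> R" for e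
    using wf that im inj_on_subset[OF inj]
    by (auto simp: wf_mhv_def simple_graph_def card_image)
  moreover have "ran (precoloring (subinstance I R k)) \<subseteq> ran (precoloring I)"
    by (auto simp: subinstance_def ran_def split: if_splits)
  ultimately show ?thesis
    using wf unfolding mhv_instances_def wf_mhv_def simple_graph_def
    by (auto simp: subinstance_def split: if_splits)
qed

lemma adj_subinstance:
  assumes "x \<in> R" "y \<in> R"
  shows "adj (subinstance I R k) (rk R x) (rk R y) \<longleftrightarrow> adj I x y"
proof -
  have "rk R ` e = rk R ` {x, y} \<longleftrightarrow> e = {x, y}" if "e \<subseteq> R" for e
    by (rule inj_on_image_eq_iff[OF inj_on_rk[OF finite_subset_verts]]) (use that assms in auto)
  then show ?thesis using assms by (auto simp: adj_def subinstance_def image_iff)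
qed

lemma pcol_subinstance: "x \<in> R \<Longrightarrow> pcol (subinstance I R k) (rk R x) = pcol I x"
  using rk_image[OF finite_subset_verts] inv_into_f_f[OF inj_on_rk[OF finite_subset_verts]]
  by (auto simp: pcol_def subinstance_def)

lemma mhv_yes_subinstance: "mhv_yes (subinstance I R k) \<longleftrightarrow> solvable I R k"
proof -
  let ?J = "subinstance I R k" and ?g = "inv_into R (rk R)"
  have inj: "inj_on (rk R) R" and im: "rk R ` R = {..<card R}"
    using finite_subset_verts by (simp_all add: inj_on_rk rk_image)
  have "wf_mhv ?J" using subinstance_instance by (auto simp: mhv_instances_def)
  then have "mhv_yes ?J \<longleftrightarrow> solvable ?J (rk R ` R) k"
    by (simp add: mhv_yes_iff_solvable im)
  also have "\<dots> \<longleftrightarrow> solvable I R k"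
  proof
    show "solvable ?J (rk R ` R) k \<Longrightarrow> solvable I R k"
      by (rule solvable_image[where g = "rk R"])
         (simp_all add: inj adj_subinstance pcol_subinstance)
    assume "solvable I R k"
    moreover have "?g ` (rk R ` R) = R" unfolding image_image using inj by simp
    ultimately have "solvable I (?g ` (rk R ` R)) k" by simp
    then show "solvable ?J (rk R ` R) k"
    proof (rule solvable_image[rotated -1])
      show "inj_on ?g (rk R ` R)" by (rule inj_on_inv_into) simp
    qed (use inj in \<open>auto simp: adj_subinstance pcol_subinstance\<close>)
  qed
  finally show ?thesis .
qed

end

section \<open>A greedy matching in the complement graph\<close>

context
  notes conj_cong [fundef_cong]
begin

text \<open>The value \<open>Suc u\<close> matches \<open>v\<close> to the smaller non-neighbour
  \<open>u\<close>; 0 means that \<open>v\<close> finds no free smaller vertex. Every pair is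
  recorded at its larger endpoint only, so the smaller one is recognised as taken by searching for
  some \<open>w\<close> with value \<open>Suc u\<close>. The congruence rule makes the guards
  \<open>u < v\<close> and \<open>w < v\<close> available to the termination proof.\<close>

function partner :: "(nat \<Rightarrow> nat \<Rightarrow> bool) \<Rightarrow> nat \<Rightarrow> nat" where
  "partner E v =
     (if \<exists>u. u < v \<and> \<not> E u v \<and> partner E u = 0 \<and> \<not> (\<exists>w. w < v \<and> partner E w = Suc u)
      then Suc (LEAST u. u < v \<and> \<not> E u v \<and> partner E u = 0 \<and> \<not> (\<exists>w. w < v \<and> partner E w = Suc u))
      else 0)"
  by pat_completeness auto
termination by (relation "measure snd") auto

end

declare partner.simps [simp del]

lemma partner_SucD:
  assumes "partner E v = Suc u"
  shows "u < v \<and> \<not> E u v \<and> partner E u = 0 \<and> \<not> (\<exists>w. w < v \<and> partner E w = Suc u)"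
proof -
  let ?P = "\<lambda>u. u < v \<and> \<not> E u v \<and> partner E u = 0 \<and> \<not> (\<exists>w. w < v \<and> partner E w = Suc u)"
  have "Ex ?P" "u = Least ?P" using assms partner.simps[of E v] by (auto split: if_splits)
  have "?P (Least ?P)" by (rule LeastI_ex) fact
  then show "?P u" unfolding \<open>u = Least ?P\<close> .
qed

lemma partner_0D:
  assumes "partner E v = 0" "u < v" "\<not> E u v" "partner E u = 0"
  shows "\<exists>w<v. partner E w = Suc u"
  using assms partner.simps[of E v] by (auto split: if_splits)

definition matched :: "(nat \<Rightarrow> nat \<Rightarrow> bool) \<Rightarrow> nat \<Rightarrow> nat set" where
  "matched E n = {v. v < n \<and> (partner E v \<noteq> 0 \<or> (\<exists>w<n. partner E w = Suc v))}"

text \<open>If both ends of a non-edge stayed unmatched, the smaller one would have been free for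
  the larger one.\<close>

lemma matched_maximal:
  assumes "u < v" "v < n" "u \<notin> matched E n" "v \<notin> matched E n"
  shows "E u v"
proof (rule ccontr)
  assume "\<not> E u v"
  then obtain w where "w < v" "partner E w = Suc u"
    using partner_0D[of E v u] assms by (auto simp: matched_def)
  then show False using assms by (auto simp: matched_def)
qed

text \<open>The set \<open>T\<close> is a vertex cover of the complement graph. Each matching pair,
  represented by its larger endpoint in \<open>X\<close>, is sent by \<open>g\<close> to an endpoint
  in \<open>T\<close>; as pairs are disjoint, \<open>g\<close> is injective.\<close>

lemma card_matched_le:
  assumes cover: "\<And>u v. u < v \<Longrightarrow> v < n \<Longrightarrow> \<not> E u v \<Longrightarrow> u \<in> T \<or> v \<in> T" and T: "finite T"
  shows "card (matched E n) \<le> 2 * card T"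
proof -
  define X where "X = {v. v < n \<and> partner E v \<noteq> 0}"
  define g where "g v = (if v \<in> T then v else partner E v - 1)" for v
  have fin: "finite X" by (simp add: X_def)
  have pr: "partner E v = Suc (partner E v - 1)" if "v \<in> X" for v
    using that by (simp add: X_def)
  have "matched E n \<subseteq> X \<union> (\<lambda>v. partner E v - 1) ` X"
    by (force simp: matched_def X_def image_iff)
  then have "card (matched E n) \<le> card (X \<union> (\<lambda>v. partner E v - 1) ` X)"
    by (intro card_mono) (simp_all add: fin)
  also have "\<dots> \<le> card X + card X"
    using card_Un_le[of X "(\<lambda>v. partner E v - 1) ` X"] card_image_le[OF fin] by (meson add_left_mono le_trans)
  also have "card X \<le> card T"
  proof (rule card_inj_on_le[of g])
    have "g v \<noteq> g w" if "v \<in> X" "w \<in> X" "v < w" for v w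
      using partner_SucD[OF pr[OF that(1)]] partner_SucD[OF pr[OF that(2)]] pr[OF that(1)] that
      by (auto simp: g_def X_def)
    then show "inj_on g X" by (metis inj_onI linorder_neqE_nat)
    show "g ` X \<subseteq> T"
      using partner_SucD[OF pr] cover by (fastforce simp: g_def X_def)
  qed (rule T)
  finally show ?thesis by simp
qed

section \<open>The kernel\<close>

definition nv :: "nat mhv \<Rightarrow> nat" where
  "nv I = card (verts (graph I))"

definition modulator :: "nat mhv \<Rightarrow> nat set" where
  "modulator I = matched (adj I) (nv I)"

definition rest :: "nat mhv \<Rightarrow> nat set" where
  "rest I = {v. v < nv I \<and> v \<notin> modulator I}"

definition cadj :: "nat mhv \<Rightarrow> nat \<Rightarrow> nat \<Rightarrow> bool" where
  "cadj I u v \<longleftrightarrow> u = v \<or> adj I u v"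

text \<open>Orders the vertices by their precolour, with ties broken by the number of the vertex.\<close>

definition key :: "nat mhv \<Rightarrow> nat \<Rightarrow> nat" where
  "key I x = pcol I x * nv I + x"

definition conflicting :: "nat mhv \<Rightarrow> nat \<Rightarrow> bool" where
  "conflicting I v \<longleftrightarrow>
     (\<exists>y<nv I. \<exists>z<nv I. cadj I v y \<and> cadj I v z \<and> 0 < pcol I y \<and> pcol I y < pcol I z)"

text \<open>Singles out the lowest numbered precoloured vertex of the closed neighbourhood, so that
  \<open>kind\<close> can read off its colour by a sum.\<close>

definition first_colored :: "nat mhv \<Rightarrow> nat \<Rightarrow> nat \<Rightarrow> bool" where
  "first_colored I v y \<longleftrightarrow>
     cadj I v y \<and> 0 < pcol I y \<and> \<not> (\<exists>z<nv I. z < y \<and> cadj I v z \<and> 0 < pcol I z)"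

text \<open>The colour that a happy vertex \<open>v\<close> must have, where \<open>0\<close> stands for no constraint and \<open>-1\<close> means that
  \<open>v\<close> is never happy.\<close>

definition kind :: "nat mhv \<Rightarrow> nat \<Rightarrow> int" where
  "kind I v =
     (if conflicting I v then -1
      else \<Sum>y<nv I. if first_colored I v y then int (pcol I y) else 0)"

definition kind_count :: "nat mhv \<Rightarrow> int \<Rightarrow> nat" where
  "kind_count I t = card {v \<in> rest I. kind I v = t}"

text \<open>The inserted 0 is the value when no clique vertex has a positive kind.\<close>

definition max_kind_count :: "nat mhv \<Rightarrow> nat" where
  "max_kind_count I = Max (insert 0 ((\<lambda>v. kind_count I (kind I v)) ` {v \<in> rest I. 0 < kind I v}))"

text \<open>With s = |S| this is s * s for the common marks, 2 * (s + 1) for the colour marks, s * s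
  for the degree marks within one class, and the reserve s.\<close>

definition slack :: "nat mhv \<Rightarrow> nat" where
  "slack I = card (modulator I) * (2 * card (modulator I) + 3) + 2"

text \<open>The pair with \<open>u = w\<close> is included on purpose: it keeps a clique neighbour
  of every vertex of S that has one.\<close>

definition common_mark :: "nat mhv \<Rightarrow> nat \<Rightarrow> bool" where
  "common_mark I x \<longleftrightarrow> (\<exists>u\<in>modulator I. \<exists>w\<in>modulator I. adj I u x \<and> adj I w x \<and>
     \<not> (\<exists>y\<in>rest I. y < x \<and> adj I u y \<and> adj I w y))"

definition color_mark :: "nat mhv \<Rightarrow> nat \<Rightarrow> bool" where
  "color_mark I x \<longleftrightarrow> 0 < pcol I x \<and> (\<exists>u<nv I. cadj I u x \<and>
     (\<not> (\<exists>y\<in>rest I. cadj I u y \<and> 0 < pcol I y \<and> key I y < key I x) \<or>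
      \<not> (\<exists>y\<in>rest I. cadj I u y \<and> 0 < pcol I y \<and> key I x < key I y)))"

definition degree_mark :: "nat mhv \<Rightarrow> nat \<Rightarrow> bool" where
  "degree_mark I x \<longleftrightarrow> (\<exists>u\<in>modulator I. adj I u x \<and>
     rk {y \<in> rest I. kind I y = kind I x \<and> adj I u y} x < card (modulator I))"

definition marked :: "nat mhv \<Rightarrow> nat \<Rightarrow> bool" where
  "marked I x \<longleftrightarrow> common_mark I x \<or> color_mark I x \<or> degree_mark I x"

text \<open>All positive kinds have the same surplus, since they compete for being the colour of the clique;
  kind \<open>1\<close> represents them below.\<close>

definition surplus :: "nat mhv \<Rightarrow> int \<Rightarrow> nat" where
  "surplus I t = (if t = 0 then kind_count I 0 else max_kind_count I) - slack I"

definition unmarked :: "nat mhv \<Rightarrow> int \<Rightarrow> nat set" where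
  "unmarked I t = {y \<in> rest I. \<not> marked I y \<and> kind I y = t}"

text \<open>For small thresholds the answer is yes unless there are vertices but no colours. Keeping one vertex
  takes care of this case.\<close>

definition kernel_set :: "nat mhv \<Rightarrow> nat set" where
  "kernel_set I =
     (if int (kind_count I 0 + max_kind_count I) < threshold I
      then modulator I \<union> {x \<in> rest I. marked I x \<or>
             0 \<le> kind I x \<and> surplus I (kind I x) \<le> rk (unmarked I (kind I x)) x}
      else {v. v < nv I \<and> v = 0})"

definition kernel_threshold :: "nat mhv \<Rightarrow> int" where
  "kernel_threshold I =
     (if int (kind_count I 0 + max_kind_count I) < threshold I
      then threshold I - int (surplus I 0) - int (surplus I 1) else 0)"

definition kernel :: "nat mhv \<Rightarrow> nat mhv" where
  "kernel I = subinstance I (kernel_set I) (kernel_threshold I)"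

lemma card_le_1I: "(\<And>x y. x \<in> A \<Longrightarrow> y \<in> A \<Longrightarrow> x = y) \<Longrightarrow> card A \<le> Suc 0"
  by (cases "finite A") (auto simp: card_le_Suc0_iff_eq)

lemma card_UN_le_mult:
  assumes "finite A" "\<And>a. a \<in> A \<Longrightarrow> card (B a) \<le> m"
  shows "card (\<Union>a\<in>A. B a) \<le> card A * m"
proof -
  have "card (\<Union>a\<in>A. B a) \<le> (\<Sum>a\<in>A. card (B a))" by (rule card_UN_le) fact
  also have "\<dots> \<le> of_nat (card A) * m" by (rule sum_bounded_above) (rule assms(2))
  finally show ?thesis by simp
qed

locale kernelization =
  fixes I :: "nat mhv"
  assumes instance_I: "I \<in> mhv_instances"
begin

abbreviation "V \<equiv> {..<nv I}"
abbreviation "S \<equiv> modulator I"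
abbreviation "C \<equiv> rest I"
abbreviation "s \<equiv> card S"

lemma wf: "wf_mhv I" and verts_eq: "verts (graph I) = V"
  using instance_I unfolding mhv_instances_def nv_def by blast+

lemma S_subset: "S \<subseteq> V" and finite_S: "finite S"
  and C_subset: "C \<subseteq> V" and finite_C: "finite C" and S_C_disjoint: "S \<inter> C = {}"
  by (auto simp: modulator_def rest_def matched_def)

lemma V_cases: "v \<in> V \<Longrightarrow> v \<in> S \<or> v \<in> C"
  by (auto simp: rest_def)

lemma clique: "u \<in> C \<Longrightarrow> v \<in> C \<Longrightarrow> u \<noteq> v \<Longrightarrow> adj I u v"
proof (cases "u < v")
  case True
  moreover assume "u \<in> C" "v \<in> C"
  ultimately show ?thesis
    by - (rule matched_maximal[of u v "nv I" "adj I"], simp_all add: rest_def modulator_def)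
next
  case False
  moreover assume "u \<in> C" "v \<in> C" "u \<noteq> v"
  ultimately show ?thesis
    by - (subst adj_sym, rule matched_maximal[of v u "nv I" "adj I"], simp_all add: rest_def modulator_def)
qed

lemma cadj_C: "u \<in> C \<Longrightarrow> v \<in> C \<Longrightarrow> cadj I u v"
  using clique[of u v] by (auto simp: cadj_def)

lemma cadj_sym: "cadj I u v \<longleftrightarrow> cadj I v u"
  using adj_sym[of I u v] unfolding cadj_def by blast

text \<open>Vertex numbers are below \<open>nv I\<close>, so a difference in precolour outweighs the
  tie-breaking summand.\<close>

lemma key_le_imp: "x \<in> V \<Longrightarrow> y \<in> V \<Longrightarrow> key I x \<le> key I y \<Longrightarrow> pcol I x \<le> pcol I y"
proof (rule ccontr)
  assume "x \<in> V" "y \<in> V" and le: "key I x \<le> key I y" and "\<not> pcol I x \<le> pcol I y"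
  have "Suc (pcol I y) * nv I \<le> pcol I x * nv I"
    by (rule mult_le_mono1) (use \<open>\<not> pcol I x \<le> pcol I y\<close> in linarith)
  moreover have "y < nv I" using \<open>y \<in> V\<close> by simp
  ultimately show False using le unfolding key_def mult_Suc by linarith
qed

lemma inj_on_key: "inj_on (key I) V"
proof (rule inj_onI)
  fix x y assume "x \<in> V" "y \<in> V" "key I x = key I y"
  then have "pcol I x = pcol I y" by (intro antisym key_le_imp) auto
  then show "x = y" using \<open>key I x = key I y\<close> by (simp add: key_def)
qed

section \<open>Kinds and the colours of happy vertices\<close>

lemma kind_ge: "kind I v = -1 \<and> conflicting I v \<or> 0 \<le> kind I v \<and> \<not> conflicting I v"
  by (cases "conflicting I v") (simp_all add: kind_def sum_nonneg)

lemma kind_less_0: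
  assumes "kind I v < 0"
  shows "\<exists>y\<in>V. \<exists>z\<in>V. cadj I v y \<and> cadj I v z \<and> pcol I y \<noteq> 0 \<and> pcol I z \<noteq> 0 \<and> pcol I y \<noteq> pcol I z"
proof -
  have "conflicting I v" using assms kind_ge[of v] by linarith
  then obtain y z where "y < nv I" "z < nv I" "cadj I v y" "cadj I v z"
    "0 < pcol I y" "pcol I y < pcol I z" unfolding conflicting_def by blast
  then show ?thesis by (intro bexI[of _ y] bexI[of _ z]) auto
qed

text \<open>Only the lowest numbered precoloured vertex \<open>m\<close> of the closed neighbourhood
  contributes to the sum, and without a conflict all others carry the same precolour.\<close>

lemma kind_eq_pcol:
  assumes "0 \<le> kind I v" "y \<in> V" "cadj I v y" "pcol I y \<noteq> 0"
  shows "kind I v = int (pcol I y)"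
proof -
  have nc: "\<not> conflicting I v" using assms(1) kind_ge[of v] by linarith
  let ?P = "\<lambda>y. y < nv I \<and> cadj I v y \<and> 0 < pcol I y"
  define m where "m = (LEAST y. ?P y)"
  have m: "?P m" unfolding m_def by (rule LeastI[of ?P y]) (use assms in auto)
  have least: "m \<le> z" if "?P z" for z unfolding m_def by (rule Least_le) fact
  have first: "first_colored I v y \<longleftrightarrow> y = m"
    if "y < nv I" for y
  proof
    assume "first_colored I v y"
    then have "m \<le> y" "\<not> m < y" using m least[of y] that unfolding first_colored_def by blast+
    then show "y = m" by simp
  next
    assume "y = m"
    then show "first_colored I v y"
      unfolding first_colored_def using m least leD by blast
  qed
  have "kind I v = (\<Sum>y<nv I. if y = m then int (pcol I y) else 0)"
    unfolding kind_def if_not_P[OF nc] by (intro sum.cong) (simp_all add: first)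
  also have "\<dots> = int (pcol I m)" using m by (simp add: sum.delta)
  also have "pcol I m = pcol I y"
  proof (rule ccontr)
    assume "pcol I m \<noteq> pcol I y"
    then consider "pcol I m < pcol I y" | "pcol I y < pcol I m" by linarith
    then show False using nc m assms unfolding conflicting_def by cases auto
  qed
  finally show ?thesis .
qed

lemma kind_pos:
  assumes "0 < kind I v"
  shows "\<exists>y\<in>V. cadj I v y \<and> pcol I y \<noteq> 0 \<and> kind I v = int (pcol I y)"
proof (rule ccontr)
  assume "\<not> ?thesis"
  then have "\<not> (\<exists>y\<in>V. cadj I v y \<and> pcol I y \<noteq> 0)" using kind_eq_pcol[of v] assms by auto
  moreover have "\<not> conflicting I v" using assms kind_ge[of v] by linarith
  ultimately have "kind I v = 0" unfolding kind_def first_colored_def by (auto intro!: sum.neutral)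
  then show False using assms by simp
qed

lemma happy_cadj: "v \<in> happy_in I R c \<Longrightarrow> u \<in> R \<Longrightarrow> cadj I u v \<Longrightarrow> c u = c v"
  by (auto simp: happy_in_def cadj_def)

text \<open>A happy vertex shares its colour with every precoloured vertex of its closed
  neighbourhood. This excludes conflicts, and it identifies a positive kind with the colour of the
  vertex.\<close>

lemma kind_of_happy:
  assumes c: "valid_on I V c" and v: "v \<in> happy_in I V c"
  shows "kind I v = 0 \<or> kind I v = int (c v)"
proof -
  have *: "c v = pcol I y" if "y \<in> V" "cadj I v y" "pcol I y \<noteq> 0" for y
    using happy_cadj[OF v, of y] that c by (auto simp: valid_on_def cadj_sym)
  show ?thesis
  proof (cases "kind I v" "0 :: int" rule: linorder_cases)
    case less
    then obtain y z where "y \<in> V" "z \<in> V" "cadj I v y" "cadj I v z" "pcol I y \<noteq> 0" "pcol I z \<noteq> 0"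
      "pcol I y \<noteq> pcol I z" using kind_less_0[of v] by blast
    then show ?thesis using *[of y] *[of z] by simp
  next
    case greater
    then obtain y where "y \<in> V" "cadj I v y" "pcol I y \<noteq> 0" "kind I v = int (pcol I y)"
      using kind_pos[of v] by blast
    then show ?thesis using *[of y] by simp
  qed simp
qed

lemma happy_monochromatic:
  assumes "v \<in> C \<inter> R" "v \<in> happy_in I R c" "x \<in> C \<inter> R"
  shows "c x = c v"
  using happy_cadj[OF assms(2), of x] cadj_C[of x v] assms by blast

lemma kind_count_le: "0 < t \<Longrightarrow> kind_count I t \<le> max_kind_count I"
proof (cases "\<exists>v\<in>C. kind I v = t")
  case True
  assume "0 < t"
  then have "kind_count I t \<in> insert 0 ((\<lambda>v. kind_count I (kind I v)) ` {v \<in> C. 0 < kind I v})"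
    using True by auto
  then show ?thesis unfolding max_kind_count_def using finite_C by (intro Max_ge) auto
next
  case False
  then have "{v \<in> C. kind I v = t} = {}" by blast
  then have "kind_count I t = 0" unfolding kind_count_def by (simp only: card.empty)
  then show ?thesis by simp
qed

lemma max_kind_count_cases: "max_kind_count I = 0 \<or> (\<exists>v\<in>C. 0 < kind I v \<and> max_kind_count I = kind_count I (kind I v))"
proof -
  have "max_kind_count I \<in> insert 0 ((\<lambda>v. kind_count I (kind I v)) ` {v \<in> C. 0 < kind I v})"
    unfolding max_kind_count_def using finite_C by (intro Max_in) auto
  then show ?thesis by auto
qed

section \<open>Counting the marked vertices\<close>

lemma card_common_mark: "card {x \<in> C. common_mark I x} \<le> s * s"
proof -
  define B where "B uw = {x \<in> C. adj I (fst uw) x \<and> adj I (snd uw) x \<and>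
     \<not> (\<exists>y\<in>C. y < x \<and> adj I (fst uw) y \<and> adj I (snd uw) y)}" for uw
  have "{x \<in> C. common_mark I x} \<subseteq> (\<Union>uw\<in>S \<times> S. B uw)"
    unfolding common_mark_def B_def by fastforce
  then have "card {x \<in> C. common_mark I x} \<le> card (\<Union>uw\<in>S \<times> S. B uw)"
    by (rule card_mono[rotated]) (use finite_S finite_C in \<open>auto simp: B_def\<close>)
  also have "card (B uw) \<le> 1" for uw
    unfolding One_nat_def by (rule card_le_1I) (auto simp: B_def, metis linorder_neqE_nat)
  then have "card (\<Union>uw\<in>S \<times> S. B uw) \<le> card (S \<times> S) * 1"
    by (intro card_UN_le_mult) (simp_all add: finite_S)
  finally show ?thesis by (simp add: card_cartesian_product)
qed

text \<open>Closed neighbourhoods of clique vertices all contain the same precoloured clique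
  vertices. So only s + 1 different sets arise, and since \<open>key I\<close> is injective each has
  one minimum and one maximum.\<close>

lemma card_color_mark: "card {x \<in> C. color_mark I x} \<le> (s + 1) * 2"
proof -
  define N where "N u = {y \<in> C. cadj I u y \<and> 0 < pcol I y}" for u
  define lo where "lo X = {x \<in> X. \<not> (\<exists>y\<in>X. key I y < key I x)}" for X
  define hi where "hi X = {x \<in> X. \<not> (\<exists>y\<in>X. key I x < key I y)}" for X
  define \<C> where "\<C> = insert {y \<in> C. 0 < pcol I y} (N ` S)"
  have N_C: "N u = {y \<in> C. 0 < pcol I y}" if "u \<in> C" for u
    using cadj_C[OF that] by (auto simp: N_def)
  have fin: "finite \<C>" using finite_S by (simp add: \<C>_def)
  have XC: "X \<subseteq> C" if "X \<in> \<C>" for X using that by (auto simp: \<C>_def N_def)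
  have "{x \<in> C. color_mark I x} \<subseteq> (\<Union>X\<in>\<C>. lo X \<union> hi X)"
  proof
    fix x assume "x \<in> {x \<in> C. color_mark I x}"
    then obtain u where u: "u \<in> V" "x \<in> lo (N u) \<union> hi (N u)"
      by (auto simp: color_mark_def N_def lo_def hi_def)
    moreover have "N u \<in> \<C>" using V_cases[OF u(1)] N_C by (auto simp: \<C>_def)
    ultimately show "x \<in> (\<Union>X\<in>\<C>. lo X \<union> hi X)" by blast
  qed
  moreover have "finite (\<Union>X\<in>\<C>. lo X \<union> hi X)"
    by (rule finite_subset[OF _ finite_C]) (use XC in \<open>auto simp: lo_def hi_def\<close>)
  ultimately have "card {x \<in> C. color_mark I x} \<le> card (\<Union>X\<in>\<C>. lo X \<union> hi X)"
    by (rule card_mono[rotated])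
  also have "card (lo X \<union> hi X) \<le> 2" if "X \<in> \<C>" for X
  proof -
    have inj: "x = y" if "x \<in> X" "y \<in> X" "key I x = key I y" for x y
      using that XC[OF \<open>X \<in> \<C>\<close>] C_subset inj_on_key by (meson inj_onD subsetD)
    have "card (lo X) \<le> Suc 0"
      by (rule card_le_1I, rule inj) (auto simp: lo_def not_less intro: antisym)
    moreover have "card (hi X) \<le> Suc 0"
      by (rule card_le_1I, rule inj) (auto simp: hi_def not_less intro: antisym)
    ultimately show ?thesis using card_Un_le[of "lo X" "hi X"] by linarith
  qed
  then have "card (\<Union>X\<in>\<C>. lo X \<union> hi X) \<le> card \<C> * 2"
    by (intro card_UN_le_mult fin)
  also have "card \<C> \<le> s + 1"
    using card_insert_le_m1[of "s + 1" "N ` S"] card_image_le[OF finite_S, of N]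
    by (simp add: \<C>_def card_insert_if finite_S)
  finally show ?thesis by simp
qed

lemma card_degree_mark: "card {x \<in> C. kind I x = t \<and> degree_mark I x} \<le> s * s"
proof -
  define D where "D u = {y \<in> C. kind I y = t \<and> adj I u y}" for u
  have fin: "finite (D u)" for u using finite_C by (simp add: D_def)
  have "{x \<in> C. kind I x = t \<and> degree_mark I x} \<subseteq> (\<Union>u\<in>S. {x \<in> D u. rk (D u) x < s})"
    unfolding degree_mark_def D_def by fastforce
  then have "card {x \<in> C. kind I x = t \<and> degree_mark I x} \<le> card (\<Union>u\<in>S. {x \<in> D u. rk (D u) x < s})"
    by (rule card_mono[rotated]) (simp add: finite_S fin)
  also have "\<dots> \<le> s * s"
    by (intro card_UN_le_mult finite_S) (simp add: card_rk_less[OF fin])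
  finally show ?thesis .
qed

text \<open>The surviving \<open>s\<close> is the reserve for the happy vertices of S. Kind -1 is
  covered too, as its marked vertices enter the kernel.\<close>

lemma card_marked: "card {x \<in> C. kind I x = t \<and> marked I x} + s \<le> slack I"
proof -
  have "{x \<in> C. kind I x = t \<and> marked I x} \<subseteq> ({x \<in> C. common_mark I x} \<union> {x \<in> C. color_mark I x}) \<union>
      {x \<in> C. kind I x = t \<and> degree_mark I x}" by (auto simp: marked_def)
  then have "card {x \<in> C. kind I x = t \<and> marked I x} \<le> card (({x \<in> C. common_mark I x} \<union> {x \<in> C. color_mark I x}) \<union>
      {x \<in> C. kind I x = t \<and> degree_mark I x})" by (rule card_mono[rotated]) (simp add: finite_C)
  also have "\<dots> \<le> s * s + (s + 1) * 2 + s * s"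
    by (intro order.trans[OF card_Un_le] add_mono card_common_mark card_color_mark card_degree_mark)
  finally show ?thesis by (simp add: slack_def algebra_simps)
qed

lemma kind_count_split:
  "kind_count I t = card {x \<in> C. kind I x = t \<and> marked I x} + card (unmarked I t)"
proof -
  have "{v \<in> C. kind I v = t} = {x \<in> C. kind I x = t \<and> marked I x} \<union> unmarked I t"
    by (auto simp: unmarked_def)
  then show ?thesis unfolding kind_count_def
    by (simp only:) (rule card_Un_disjoint, auto simp: unmarked_def finite_C)
qed

section \<open>Deleted and retained vertices, and the size of the kernel\<close>

definition dropped :: "int \<Rightarrow> nat set" where
  "dropped t = {x \<in> unmarked I t. rk (unmarked I t) x < surplus I t}"

definition retained :: "int \<Rightarrow> nat set" where
  "retained t = {x \<in> C. kind I x = t} - dropped t"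

lemma finite_unmarked: "finite (unmarked I t)" and finite_dropped: "finite (dropped t)"
  and finite_retained: "finite (retained t)"
  using finite_C by (auto simp: unmarked_def dropped_def retained_def)

lemma card_dropped: "card (dropped t) = min (surplus I t) (card (unmarked I t))"
  unfolding dropped_def by (rule card_rk_less[OF finite_unmarked])

lemma dropped_subset: "dropped t \<subseteq> {x \<in> C. kind I x = t}"
  by (auto simp: dropped_def unmarked_def)

lemma card_retained: "card (retained t) = kind_count I t - card (dropped t)"
  unfolding retained_def kind_count_def by (rule card_Diff_subset[OF finite_dropped dropped_subset])

lemma surplus_pos_kind: "0 < t \<Longrightarrow> surplus I t = surplus I 1"
  by (simp add: surplus_def)

text \<open>The marked vertices fit into \<open>slack I\<close>, so the unconstrained class can
  always lose its whole surplus. Positive classes may fail to, because their surplus refers to the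
  largest one.\<close>

lemma surplus_0_le: "surplus I 0 \<le> card (unmarked I 0)"
  using kind_count_split[of 0] card_marked[of 0] by (simp add: surplus_def)

text \<open>Either the full surplus is removed from a class that is no larger than the count
  defining the surplus, or all unmarked vertices are gone and the marked ones fit into
  \<open>slack I\<close>.\<close>

lemma card_retained_le:
  assumes "0 \<le> t"
  shows "card (retained t) \<le> slack I"
proof (cases "surplus I t \<le> card (unmarked I t)")
  case True
  then show ?thesis
    using assms kind_count_le[of t] by (auto simp: card_retained card_dropped surplus_def)
next
  case False
  then show ?thesis
    using card_marked[of t] kind_count_split[of t] by (simp add: card_retained card_dropped)
qed

text \<open>A positive kind is the precolour of some vertex \<open>y\<close> in the closed
  neighbourhood. If \<open>y\<close> is in the clique, then \<open>v\<close> sees it as well and the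
  kind is that of \<open>v\<close>; all other kinds are precolours from S.\<close>

lemma card_positive_kinds: "card {t. 0 < t \<and> (\<exists>v\<in>C. kind I v = t)} \<le> s + 1"
proof (cases "\<exists>v\<in>C. 0 < kind I v")
  case True
  then obtain v where v: "v \<in> C" "0 < kind I v" by blast
  have sub: "{t. 0 < t \<and> (\<exists>v\<in>C. kind I v = t)} \<subseteq> insert (kind I v) (int ` pcol I ` S)"
  proof
    fix t assume "t \<in> {t. 0 < t \<and> (\<exists>v\<in>C. kind I v = t)}"
    then obtain w where w: "w \<in> C" "kind I w = t" "0 < t" by blast
    then obtain y where y: "y \<in> V" "cadj I w y" "pcol I y \<noteq> 0" "t = int (pcol I y)"
      using kind_pos[of w] by auto
    have "t = kind I v" if "y \<in> C"
      using kind_eq_pcol[of v y] y v cadj_C[OF v(1) that] by simp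
    then show "t \<in> insert (kind I v) (int ` pcol I ` S)" using V_cases[OF y(1)] y(4) by blast
  qed
  have "card {t. 0 < t \<and> (\<exists>v\<in>C. kind I v = t)} \<le> card (insert (kind I v) (int ` pcol I ` S))"
    by (rule card_mono[OF _ sub]) (simp add: finite_S)
  also have "\<dots> \<le> Suc (card (int ` pcol I ` S))" by (simp add: card_insert_if finite_S)
  also have "\<dots> \<le> Suc s"
    using card_image_le[OF finite_S, of "pcol I"] card_image_le[of "pcol I ` S" int] finite_S by simp
  finally show ?thesis by simp
next
  case False
  then have "{t. 0 < t \<and> (\<exists>v\<in>C. kind I v = t)} = {}" by blast
  then show ?thesis by (simp only: card.empty)
qed

lemma kernel_set_subset: "kernel_set I \<subseteq> verts (graph I)"
  using S_subset C_subset unfolding kernel_set_def verts_eq by auto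

lemma kernel_instance: "kernel I \<in> mhv_instances"
  unfolding kernel_def by (rule subinstance_instance[OF wf kernel_set_subset])

text \<open>The factor s + 3 counts kind -1, kind 0 and at most s + 1 positive kinds. Of kind -1
  only marked vertices survive.\<close>

lemma card_kernel_set: "card (kernel_set I) \<le> s + (s + 3) * slack I"
proof (cases "int (kind_count I 0 + max_kind_count I) < threshold I")
  case False
  then have "kernel_set I \<subseteq> {0}" by (auto simp: kernel_set_def)
  then have "card (kernel_set I) \<le> 1" using card_mono[of "{0}" "kernel_set I"] by simp
  then show ?thesis by (simp add: slack_def)
next
  case True
  define T where "T = {t. 0 < t \<and> (\<exists>v\<in>C. kind I v = t)}"
  have finT: "finite T"
    by (rule finite_subset[of _ "kind I ` C"]) (auto simp: T_def finite_C)
  have sub: "kernel_set I \<subseteq> (S \<union> {x \<in> C. kind I x = -1 \<and> marked I x}) \<union> (\<Union>t\<in>insert 0 T. retained t)"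
  proof
    fix x assume x: "x \<in> kernel_set I"
    show "x \<in> (S \<union> {x \<in> C. kind I x = -1 \<and> marked I x}) \<union> (\<Union>t\<in>insert 0 T. retained t)"
    proof (cases "x \<in> C \<and> 0 \<le> kind I x")
      case True
      then have "x \<in> retained (kind I x)" "kind I x \<in> insert 0 T"
        using x \<open>int (kind_count I 0 + max_kind_count I) < threshold I\<close> S_C_disjoint
        by (auto simp: kernel_set_def retained_def dropped_def unmarked_def T_def)
      then show ?thesis by blast
    next
      case False
      then show ?thesis
        using x \<open>int (kind_count I 0 + max_kind_count I) < threshold I\<close> kind_ge[of x] by (auto simp: kernel_set_def)
    qed
  qed
  have "card (kernel_set I) \<le> card ((S \<union> {x \<in> C. kind I x = -1 \<and> marked I x}) \<union> (\<Union>t\<in>insert 0 T. retained t))"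
    by (rule card_mono[OF _ sub]) (simp add: finite_S finite_C finT finite_retained)
  also have "\<dots> \<le> (s + slack I) + card (insert 0 T) * slack I"
  proof (intro order.trans[OF card_Un_le] add_mono order.refl)
    show "card {x \<in> C. kind I x = -1 \<and> marked I x} \<le> slack I"
      using card_marked[of "-1"] by simp
    show "card (\<Union>t\<in>insert 0 T. retained t) \<le> card (insert 0 T) * slack I"
      by (rule card_UN_le_mult, simp add: finT) (auto simp: T_def intro!: card_retained_le)
  qed
  also have "card (insert 0 T) \<le> s + 2"
    using card_positive_kinds finT by (simp add: card_insert_if T_def)
  finally show ?thesis by (simp add: algebra_simps)
qed

lemma adj_swap: "adj I u v \<Longrightarrow> adj I v u"
  by (subst adj_sym)

lemma cadj_swap: "adj I u v \<Longrightarrow> cadj I v u"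
  unfolding cadj_def by (rule disjI2, rule adj_swap)

text \<open>If there is a colour, giving a best supported one to all vertices without a precolour
  shows that both sides hold. If there is none, only the empty graph can be coloured, and for it the
  assumption bounds the threshold by 0.\<close>

lemma solvable_trivial:
  assumes "\<not> int (kind_count I 0 + max_kind_count I) < threshold I"
  shows "solvable I V (threshold I) \<longleftrightarrow> solvable I {v. v < nv I \<and> v = 0} 0"
proof (cases "num_colors I = 0")
  case True
  show ?thesis
  proof (cases "nv I = 0")
    case nv: True
    then have "C = {}" using C_subset by auto
    then have "kind_count I 0 + max_kind_count I = 0" by (simp add: kind_count_def max_kind_count_def)
    then show ?thesis using assms nv by (simp add: solvable_def valid_on_def happy_in_def)
  next
    case False
    then have "\<not> valid_on I V c" "\<not> valid_on I {v. v < nv I \<and> v = 0} c" for c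
      using True by (auto simp: valid_on_def)
    then show ?thesis by (simp add: solvable_def)
  qed
next
  case False
  define a where "a = (if max_kind_count I = 0 then 1 else nat (SOME t. 0 < t \<and> (\<exists>v\<in>C. kind I v = t) \<and> max_kind_count I = kind_count I t))"
  have a: "a \<in> {1..num_colors I} \<and> max_kind_count I \<le> kind_count I (int a)"
  proof (cases "max_kind_count I = 0")
    case True
    then show ?thesis using False by (simp add: a_def)
  next
    case nz: False
    let ?P = "\<lambda>t. 0 < t \<and> (\<exists>v\<in>C. kind I v = t) \<and> max_kind_count I = kind_count I t"
    have "?P (SOME t. ?P t)"
      by (rule someI_ex) (use nz max_kind_count_cases in auto)
    moreover have "int a = (SOME t. ?P t)" using nz calculation by (simp add: a_def)
    ultimately have P: "?P (int a)" by simp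
    then obtain v where "kind I v = int a" "0 < kind I v" by auto
    then obtain y where "a = pcol I y" using kind_pos[of v] by auto
    then show ?thesis using P pcol_le[OF wf, of y] by simp
  qed
  define c where "c v = (if pcol I v \<noteq> 0 then pcol I v else a)" for v
  have valid: "valid_on I R c" for R
    using a pcol_le[OF wf] by (auto simp: valid_on_def c_def Suc_le_eq)
  let ?K = "\<lambda>t. {v \<in> C. kind I v = t}"
  have "?K 0 \<union> ?K (int a) \<subseteq> happy_in I V c"
  proof
    fix v assume v: "v \<in> ?K 0 \<union> ?K (int a)"
    have "c y = a" if "y \<in> V" "cadj I v y" for y
      using kind_eq_pcol[of v y] that v by (auto simp: c_def)
    moreover have "v \<in> V" "cadj I v v" using v C_subset by (auto simp: cadj_def)
    ultimately show "v \<in> happy_in I V c"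
      by (auto simp: happy_in_def dest: cadj_swap)
  qed
  then have "card (?K 0 \<union> ?K (int a)) \<le> card (happy_in I V c)"
    by (rule card_mono[rotated]) (simp add: happy_in_def)
  also have "card (?K 0 \<union> ?K (int a)) = kind_count I 0 + kind_count I (int a)"
    unfolding kind_count_def by (rule card_Un_disjoint) (use a finite_C in auto)
  finally have "threshold I \<le> int (card (happy_in I V c))" using a assms by simp
  then have "solvable I V (threshold I)" unfolding solvable_def using valid by blast
  moreover have "solvable I {v. v < nv I \<and> v = 0} 0"
    unfolding solvable_def by (rule exI[of _ c]) (simp add: valid)
  ultimately show ?thesis by simp
qed

lemma happy_restrict: "v \<in> happy_in I V c \<Longrightarrow> v \<in> R \<Longrightarrow> R \<subseteq> V \<Longrightarrow> v \<in> happy_in I R c"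
  by (auto simp: happy_in_def)

lemma finite_happy: "finite R \<Longrightarrow> finite (happy_in I R c)"
  by (simp add: happy_in_def)

lemma surplus_le:
  assumes "0 < t" shows "surplus I t \<le> surplus I 1"
  using assms by (simp add: surplus_def)

section \<open>Equivalence for large thresholds\<close>

context
  assumes large: "int (kind_count I 0 + max_kind_count I) < threshold I"
begin

abbreviation "R \<equiv> kernel_set I"

lemma kernel_set_large: "R = S \<union> {x \<in> C. marked I x \<or> 0 \<le> kind I x \<and> surplus I (kind I x) \<le> rk (unmarked I (kind I x)) x}"
  and threshold_R: "kernel_threshold I = threshold I - int (surplus I 0) - int (surplus I 1)"
  using large by (simp_all add: kernel_set_def kernel_threshold_def)

lemma S_R: "S \<subseteq> R" and R_V: "R \<subseteq> V" and marked_R: "x \<in> C \<Longrightarrow> marked I x \<Longrightarrow> x \<in> R"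
  using S_subset C_subset by (auto simp: kernel_set_large)

lemma finite_kernel: "finite R"
  using R_V finite_subset by blast

lemma dropped_iff: "0 \<le> kind I x \<Longrightarrow> x \<in> dropped (kind I x) \<longleftrightarrow> x \<in> C \<and> x \<notin> R"
  using S_C_disjoint by (auto simp: dropped_def unmarked_def kernel_set_large)

lemma retained_iff: "0 \<le> kind I x \<Longrightarrow> x \<in> retained (kind I x) \<longleftrightarrow> x \<in> C \<and> x \<in> R"
  using dropped_iff[of x] by (auto simp: retained_def)

text \<open>Restriction keeps retained happy vertices happy, so only deleted happy vertices are
  lost. If there are any, the clique has a single colour, and the lost vertices were dropped from
  kind 0 or from the kind of this colour.\<close>

lemma solvable_forward:
  assumes "solvable I V (threshold I)"
  shows "solvable I R (kernel_threshold I)"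
proof -
  obtain c where c: "valid_on I V c" "threshold I \<le> int (card (happy_in I V c))"
    using assms by (auto simp: solvable_def)
  let ?H = "happy_in I V c"
  have "card (?H - R) \<le> surplus I 0 + surplus I 1"
  proof (cases "?H \<inter> C = {}")
    case True
    then have "?H - R = {}" using V_cases S_R by (fastforce simp: happy_in_def)
    then show ?thesis by (simp only: card.empty)
  next
    case False
    then obtain v where v: "v \<in> C \<inter> V" "v \<in> ?H" using C_subset by auto
    have "c v \<in> {1..num_colors I}" using v(1) c(1) unfolding valid_on_def by blast
    then have "0 < c v" by simp
    have "?H - R \<subseteq> dropped 0 \<union> dropped (int (c v))"
    proof
      fix x assume x: "x \<in> ?H - R"
      then have xC: "x \<in> C \<inter> V" using V_cases[of x] S_R by (auto simp: happy_in_def)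
      then have "c x = c v" using happy_monochromatic[OF v xC] by simp
      then have "kind I x = 0 \<or> kind I x = int (c v)" using kind_of_happy[OF c(1), of x] x by simp
      then show "x \<in> dropped 0 \<union> dropped (int (c v))" using dropped_iff[of x] x xC by auto
    qed
    then have "card (?H - R) \<le> card (dropped 0 \<union> dropped (int (c v)))"
      by (rule card_mono[rotated]) (simp add: finite_dropped)
    also have "\<dots> \<le> card (dropped 0) + card (dropped (int (c v)))" by (rule card_Un_le)
    also have "\<dots> \<le> surplus I 0 + surplus I 1"
      using surplus_le[of "int (c v)"] \<open>0 < c v\<close> by (simp add: card_dropped)
    finally show ?thesis .
  qed
  moreover have "card ?H \<le> card (?H \<inter> R) + card (?H - R)"
    using card_Un_le[of "?H \<inter> R" "?H - R"] by (simp add: Int_Diff_Un)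
  moreover have "card (?H \<inter> R) \<le> card (happy_in I R c)"
    by (rule card_mono) (use finite_kernel happy_restrict[OF _ _ R_V] in \<open>auto simp: finite_happy\<close>)
  ultimately have "kernel_threshold I \<le> int (card (happy_in I R c))"
    using c(2) by (simp add: threshold_R)
  moreover have "valid_on I R c" using c(1) R_V by (auto simp: valid_on_def)
  ultimately show ?thesis by (auto simp: solvable_def)
qed

context
  fixes c :: "nat \<Rightarrow> nat"
  assumes c: "valid_on I R c"
begin

abbreviation "H \<equiv> happy_in I R c"

text \<open>The vertex \<open>x\<close> may have been deleted. The precoloured neighbours
  \<open>l\<close> and \<open>h\<close> of extreme key are marked, hence retained and coloured like
  the happy vertex \<open>u\<close>, and the precolour of \<open>x\<close> lies between
  theirs.\<close>

lemma happy_precolored: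
  assumes u: "u \<in> H" and x: "x \<in> C" "cadj I u x" "pcol I x \<noteq> 0"
  shows "pcol I x = c u"
proof -
  define X where "X = {y \<in> C. cadj I u y \<and> 0 < pcol I y}"
  have X: "finite X" "x \<in> X" using finite_C x by (auto simp: X_def)
  have uV: "u < nv I" using u R_V by (auto simp: happy_in_def)
  have *: "pcol I y = c u" if "y \<in> X" "color_mark I y" for y
  proof -
    have y: "y \<in> R" using that marked_R by (auto simp: X_def marked_def)
    then have "c y = c u" using happy_cadj[OF u, of y] that(1) by (simp add: X_def cadj_sym)
    then show ?thesis using c y that(1) by (auto simp: valid_on_def X_def)
  qed
  obtain l where l: "l \<in> X" "\<And>y. y \<in> X \<Longrightarrow> key I l \<le> key I y"
  proof -
    have "Min (key I ` X) \<in> key I ` X" by (rule Min_in) (use X in auto)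
    then obtain l where "l \<in> X" "Min (key I ` X) = key I l" by (rule imageE)
    then show ?thesis using that Min_le[of "key I ` X"] X(1) by auto
  qed
  obtain h where h: "h \<in> X" "\<And>y. y \<in> X \<Longrightarrow> key I y \<le> key I h"
  proof -
    have "Max (key I ` X) \<in> key I ` X" by (rule Max_in) (use X in auto)
    then obtain h where "h \<in> X" "Max (key I ` X) = key I h" by (rule imageE)
    then show ?thesis using that Max_ge[of "key I ` X"] X(1) by auto
  qed
  have "color_mark I l"
    unfolding color_mark_def using l uV not_le unfolding X_def by blast
  moreover have "color_mark I h"
    unfolding color_mark_def using h uV not_le unfolding X_def by blast
  moreover have "pcol I l \<le> pcol I x" "pcol I x \<le> pcol I h"
    using l h X(2) C_subset by (auto intro!: key_le_imp simp: X_def)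
  ultimately show ?thesis using *[OF l(1)] *[OF h(1)] by simp
qed

lemma common_neighbour:
  assumes "u \<in> S" "w \<in> S" "x \<in> C" "adj I u x" "adj I w x"
  obtains y where "y \<in> C" "y \<in> R" "adj I u y" "adj I w y"
proof -
  let ?P = "\<lambda>y. y \<in> C \<and> adj I u y \<and> adj I w y"
  define y where "y = (LEAST y. ?P y)"
  have y: "?P y" unfolding y_def by (rule LeastI[of ?P x]) (use assms in blast)
  moreover have "\<not> (\<exists>z\<in>C. z < y \<and> adj I u z \<and> adj I w z)"
    unfolding y_def using not_less_Least by blast
  ultimately have "common_mark I y" using assms unfolding common_mark_def by blast
  then show ?thesis using that y marked_R by (auto simp: marked_def)
qed

lemma happy_same_color:
  assumes "u \<in> S" "w \<in> S" "u \<in> H" "w \<in> H" "x \<in> C" "adj I u x" "adj I w x"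
  shows "c u = c w"
proof -
  obtain y where "y \<in> R" "adj I u y" "adj I w y" using common_neighbour assms by metis
  then show ?thesis
    using happy_cadj[OF assms(3), of y] happy_cadj[OF assms(4), of y] cadj_swap by simp
qed

text \<open>Again \<open>x\<close> may have been deleted. The mark for the pair of \<open>u\<close>
  with itself provides a retained clique neighbour of \<open>u\<close>, whose colour both happy
  vertices determine.\<close>

lemma happy_same_color':
  assumes "u \<in> S" "u \<in> H" "x \<in> C" "adj I u x" "v \<in> C" "v \<in> H"
  shows "c u = c v"
proof -
  obtain y where y: "y \<in> C" "y \<in> R" "adj I u y" using common_neighbour assms by metis
  have "v \<in> C \<inter> R" using assms by (auto simp: happy_in_def)
  then show ?thesis
    using happy_cadj[OF assms(2) y(2)] happy_monochromatic[of v R c y] y assms cadj_swap by simp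
qed

text \<open>Colour the deleted vertices as their precolour or a happy neighbour dictates; the marked
  vertices witness that these demands never conflict.\<close>

lemma extension:
  assumes "H \<noteq> {}"
  obtains c' where "valid_on I V c'" "H \<subseteq> happy_in I V c'" "\<And>v. v \<in> R \<Longrightarrow> c' v = c v"
    "\<And>v x. v \<in> H \<Longrightarrow> v \<in> C \<Longrightarrow> x \<in> C \<Longrightarrow> c' x = c v"
proof -
  obtain v0 where v0: "v0 \<in> H" using assms by blast
  \<comment> \<open>Collects the happy vertices \<open>w\<close> that see the clique vertex
    \<open>x\<close>: each of them requires its own colour at \<open>x\<close>.\<close>
  define demand where "demand x w \<longleftrightarrow> w \<in> H \<and> (w \<in> S \<and> adj I w x \<or> w \<in> C)" for x w
  \<comment> \<open>The default \<open>c v0\<close> merely has to be an admissible colour, and the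
    happy vertex \<open>v0\<close> guarantees that there is one.\<close>
  define c' where "c' x = (if x \<in> R then c x else if pcol I x \<noteq> 0 then pcol I x
     else if \<exists>w. demand x w then c (SOME w. demand x w) else c v0)" for x
  have dem: "c' x = c w" if x: "x \<in> C" and w: "demand x w" for x w
  proof -
    have cadj: "cadj I w x" using w x cadj_C by (auto simp: demand_def cadj_def)
    have wH: "w \<in> H" using w by (simp add: demand_def)
    consider "x \<in> R" | "x \<notin> R" "pcol I x \<noteq> 0" | "x \<notin> R" "pcol I x = 0" by blast
    then show ?thesis
    proof cases
      case 1
      then show ?thesis using happy_cadj[OF wH 1] cadj by (simp add: c'_def cadj_sym)
    next
      case 2
      then show ?thesis using happy_precolored[OF wH x cadj] by (simp add: c'_def)
    next
      case 3
      define w' where "w' = (SOME w. demand x w)"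
      have w': "demand x w'" unfolding w'_def by (rule someI) (rule w)
      \<comment> \<open>Two demands agree through common neighbours if one of the vertices lies in
        S, and through the monochromatic clique otherwise.\<close>
      have "c w' = c w"
      proof (cases "w \<in> S")
        case True
        then have "adj I w x" using w S_C_disjoint by (auto simp: demand_def)
        then show ?thesis
          using happy_same_color[of w w' x] happy_same_color'[of w x w'] True wH x w'
          unfolding demand_def by metis
      next
        case False
        then have "w \<in> C" using w by (simp add: demand_def)
        moreover have "w \<in> R" "w' \<in> R" using w w' by (auto simp: demand_def happy_in_def)
        ultimately show ?thesis
          using happy_same_color'[of w' x w] happy_monochromatic[of w R c w'] wH x w'
          unfolding demand_def by blast
      qed
      then show ?thesis using 3 w by (auto simp: c'_def w'_def)
    qed
  qed
  have "valid_on I V c'"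
    unfolding valid_on_def
  proof (intro ballI conjI impI)
    fix x assume x: "x \<in> V"
    have R: "c y \<in> {1..num_colors I}" if "y \<in> R" for y using c that unfolding valid_on_def by blast
    have HR: "w \<in> R" if "w \<in> H" for w using that by (simp add: happy_in_def)
    show "c' x \<in> {1..num_colors I}"
    proof (cases "x \<in> R \<or> pcol I x \<noteq> 0 \<or> \<not> (\<exists>w. demand x w)")
      case True
      then show ?thesis using R[of x] R[OF HR[OF v0]] pcol_le[OF wf, of x] by (auto simp: c'_def Suc_le_eq)
    next
      case False
      then obtain w where w: "demand x w" by blast
      have "x \<in> C" using V_cases[OF x] S_R False by blast
      then show ?thesis using dem[OF _ w] R HR w by (simp add: demand_def)
    qed
    show "c' x = pcol I x" if "pcol I x \<noteq> 0"
      using that c by (auto simp: c'_def valid_on_def)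
  qed
  moreover have "H \<subseteq> happy_in I V c'"
  proof
    fix w assume w: "w \<in> H"
    then have wR: "w \<in> R" by (simp add: happy_in_def)
    have "c' x = c' w" if x: "x \<in> V" "adj I x w" for x
    proof (cases "x \<in> R")
      case True
      then show ?thesis using happy_cadj[OF w True] wR x(2) by (simp add: c'_def cadj_def)
    next
      case False
      then have xC: "x \<in> C" using V_cases[OF x(1)] S_R by auto
      have "w \<in> S \<or> w \<in> C" using V_cases R_V wR by auto
      then have "demand x w" using w adj_swap[OF x(2)] by (auto simp: demand_def)
      then show ?thesis using dem[OF xC] wR by (simp add: c'_def)
    qed
    then show "w \<in> happy_in I V c'" using wR R_V by (auto simp: happy_in_def)
  qed
  moreover have "c' v = c v" if "v \<in> R" for v using that by (simp add: c'_def)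
  moreover have "c' x = c v" if "v \<in> H" "v \<in> C" "x \<in> C" for v x
    using dem[of x v] that by (simp add: demand_def)
  ultimately show ?thesis using that by blast
qed

end

text \<open>The extended coloring keeps all of \<open>?H\<close> happy, so the task is to regain the
  two surpluses. They are regained by the deleted vertices of kind 0 and of the clique colour
  \<open>a\<close>: if these were too few, or one of them were unhappy, \<open>?H\<close> would be
  too small.\<close>

lemma solvable_backward:
  assumes "solvable I R (kernel_threshold I)"
  shows "solvable I V (threshold I)"
proof -
  obtain c where c: "valid_on I R c" "kernel_threshold I \<le> int (card (happy_in I R c))"
    using assms by (auto simp: solvable_def)
  let ?H = "happy_in I R c"
  \<comment> \<open>Every contradiction below rests on this: \<open>?H\<close> has more elements
    than the largest positive class and the unconstrained class have left after losing their
    surpluses.\<close>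
  have kt: "int (kind_count I 0 + max_kind_count I) < kernel_threshold I + int (surplus I 0) + int (surplus I 1)"
    using large by (simp add: threshold_R)
  have "surplus I 0 \<le> kind_count I 0" "surplus I 1 \<le> max_kind_count I" by (simp_all add: surplus_def)
  then have "0 < card ?H" using kt c(2) by linarith
  then have "?H \<noteq> {}" by auto
  then obtain c' where c': "valid_on I V c'" "?H \<subseteq> happy_in I V c'" "\<And>v. v \<in> R \<Longrightarrow> c' v = c v"
    "\<And>v x. v \<in> ?H \<Longrightarrow> v \<in> C \<Longrightarrow> x \<in> C \<Longrightarrow> c' x = c v"
    using extension[OF c(1)] by blast
  have fin: "finite (happy_in I V c')" by (simp add: happy_in_def)
  show ?thesis
  proof (cases "surplus I 0 = 0 \<and> surplus I 1 = 0")
    case True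
    then have "threshold I \<le> int (card ?H)" using c(2) by (simp add: threshold_R)
    also have "card ?H \<le> card (happy_in I V c')" by (rule card_mono[OF fin c'(2)])
    finally show ?thesis using c'(1) by (auto simp: solvable_def)
  next
    case False
    have slack: "s < slack I" by (simp add: slack_def algebra_simps)
    \<comment> \<open>A count with positive surplus is still \<open>slack I\<close> after losing it,
      and \<open>slack I\<close> exceeds \<open>s\<close>.\<close>
    have "s < card ?H"
    proof (cases "surplus I 0 = 0")
      case True
      then have "surplus I 1 = max_kind_count I - slack I" "0 < surplus I 1" using False by (auto simp: surplus_def)
      then show ?thesis using True kt c(2) slack by linarith
    next
      case 0: False
      then have "surplus I 0 = kind_count I 0 - slack I" by (simp add: surplus_def)
      then show ?thesis using 0 kt c(2) slack \<open>surplus I 1 \<le> max_kind_count I\<close> by linarith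
    qed
    have "\<not> ?H \<subseteq> S"
    proof
      assume "?H \<subseteq> S"
      then have "card ?H \<le> s" by (rule card_mono[OF finite_S])
      then show False using \<open>s < card ?H\<close> by simp
    qed
    then obtain v where v: "v \<in> ?H" "v \<in> C"
      using V_cases R_V by (force simp: happy_in_def)
    define a where "a = c v"
    have aC: "c' x = a" if "x \<in> C" for x using c'(4)[OF v that] by (simp add: a_def)
    have "v \<in> R" using v(1) by (simp add: happy_in_def)
    then have "a \<in> {1..num_colors I}" using c(1) unfolding valid_on_def a_def by blast
    then have a: "0 < int a" by simp
    let ?T = "{0, int a}"
    have HR: "?H \<subseteq> (?H \<inter> S) \<union> (retained 0 \<union> retained (int a))"
    proof
      fix w assume w: "w \<in> ?H"
      then have wR: "w \<in> R" by (simp add: happy_in_def)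
      show "w \<in> (?H \<inter> S) \<union> (retained 0 \<union> retained (int a))"
      proof (cases "w \<in> S")
        case False
        then have wC: "w \<in> C" using V_cases wR R_V by blast
        then have "kind I w \<in> ?T" using kind_of_happy[OF c'(1), of w] c'(2) w aC by auto
        then show ?thesis using retained_iff[of w] wC wR by auto
      qed (use w in simp)
    qed
    have sur_a: "surplus I (int a) = surplus I 1" by (rule surplus_pos_kind[OF a])
    have cS: "card (?H \<inter> S) \<le> s" by (rule card_mono) (auto simp: finite_S)
    have drop_0: "card (dropped 0) = surplus I 0" using surplus_0_le by (simp add: card_dropped)
    have ret_0: "card (retained 0) = kind_count I 0 - surplus I 0" by (simp add: card_retained drop_0)
    \<comment> \<open>Otherwise class \<open>a\<close> has lost all its unmarked vertices. By the
      reserve, its marked vertices and S together number at most \<open>slack I\<close>, which is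
      what remains of the largest class, so \<open>?H\<close> would be too small.\<close>
    have drop_a: "card (dropped (int a)) = surplus I 1"
    proof (rule ccontr)
      assume "card (dropped (int a)) \<noteq> surplus I 1"
      then have less: "card (unmarked I (int a)) < surplus I 1" by (simp add: card_dropped sur_a)
      then have "card (retained (int a)) + s \<le> slack I"
        using card_marked[of "int a"] kind_count_split[of "int a"]
        by (simp add: card_retained card_dropped sur_a)
      moreover have "card ?H \<le> card ((?H \<inter> S) \<union> (retained 0 \<union> retained (int a)))"
        by (rule card_mono[OF _ HR]) (simp add: finite_S finite_retained)
      moreover have "\<dots> \<le> s + (card (retained 0) + card (retained (int a)))"
        by (intro order.trans[OF card_Un_le] add_mono cS card_Un_le)
      moreover have "surplus I 1 = max_kind_count I - slack I" by (simp add: surplus_def)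
      ultimately show False using less kt c(2) ret_0 \<open>surplus I 0 \<le> kind_count I 0\<close> by linarith
    qed
    have ret_a: "card (retained (int a)) \<le> max_kind_count I - surplus I 1"
      using kind_count_le[OF a] by (simp add: card_retained drop_a)
    \<comment> \<open>A neighbour \<open>u\<close> of another colour must lie in S. As
      \<open>x\<close> is unmarked, \<open>u\<close> has \<open>s\<close> marked neighbours in the
      same class, all retained and all unhappy because of \<open>u\<close>. This loss cancels the at
      most \<open>s\<close> happy vertices of S.\<close>
    have dropped_happy: "dropped t \<subseteq> happy_in I V c'" if t: "t \<in> ?T" for t
    proof
      fix x assume x: "x \<in> dropped t"
      then have xC: "x \<in> C" and kx: "kind I x = t" and um: "\<not> marked I x"
        by (auto simp: dropped_def unmarked_def)
      have "c' u = a" if u: "u \<in> V" "adj I u x" for u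
      proof (rule ccontr)
        assume ne: "c' u \<noteq> a"
        then have uS: "u \<in> S" using V_cases[OF u(1)] aC by blast
        define D where "D = {y \<in> C. kind I y = t \<and> adj I u y}"
        have finD: "finite D" using finite_C by (simp add: D_def)
        have "\<not> rk D x < s"
          using um uS u(2) kx unfolding marked_def degree_mark_def D_def by blast
        moreover have "rk D x < card D"
          by (rule rk_less_card[OF finD]) (use xC kx u in \<open>simp add: D_def\<close>)
        ultimately have cD: "card {y \<in> D. rk D y < s} = s" by (simp add: card_rk_less[OF finD])
        let ?D = "{y \<in> D. rk D y < s}"
        have D_marked: "marked I y" if "y \<in> ?D" for y
          using that uS unfolding marked_def degree_mark_def D_def by auto
        have D_R: "y \<in> R" if "y \<in> ?D" for y
          by (rule marked_R) (use that D_marked[OF that] in \<open>auto simp: D_def\<close>)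
        have D_ret: "?D \<subseteq> retained 0 \<union> retained (int a)"
        proof
          fix y assume y: "y \<in> ?D"
          then have "y \<in> C" "kind I y = t" by (auto simp: D_def)
          then show "y \<in> retained 0 \<union> retained (int a)" using retained_iff[of y] D_R[OF y] t by auto
        qed
        have "y \<notin> ?H" if y: "y \<in> ?D" for y
        proof
          assume "y \<in> ?H"
          moreover have "adj I u y" "y \<in> C" using y by (auto simp: D_def)
          moreover have "u \<in> R" using uS S_R by blast
          ultimately have "c u = c y" using happy_cadj[of y R c u] by (simp add: cadj_def)
          then show False
            using c'(3)[OF \<open>u \<in> R\<close>] c'(3)[OF D_R[OF y]] aC[OF \<open>y \<in> C\<close>] ne by simp
        qed
        then have "?H \<subseteq> (?H \<inter> S) \<union> ((retained 0 \<union> retained (int a)) - ?D)" using HR by blast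
        then have "card ?H \<le> card ((?H \<inter> S) \<union> ((retained 0 \<union> retained (int a)) - ?D))"
          by (rule card_mono[rotated]) (simp add: finite_S finite_retained)
        also have "\<dots> \<le> s + card ((retained 0 \<union> retained (int a)) - ?D)"
          by (intro order.trans[OF card_Un_le] add_mono cS order.refl)
        also have "card ((retained 0 \<union> retained (int a)) - ?D) = card (retained 0 \<union> retained (int a)) - s"
          using card_Diff_subset[OF _ D_ret] finD cD by simp
        finally have "card ?H \<le> s + (card (retained 0 \<union> retained (int a)) - s)" .
        moreover have "s \<le> card (retained 0 \<union> retained (int a))"
          using card_mono[OF _ D_ret] cD finite_retained by simp
        moreover have "card (retained 0 \<union> retained (int a)) \<le> card (retained 0) + card (retained (int a))"
          by (rule card_Un_le)
        ultimately show False
          using kt c(2) ret_0 ret_a \<open>surplus I 0 \<le> kind_count I 0\<close> \<open>surplus I 1 \<le> max_kind_count I\<close> by linarith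
      qed
      then show "x \<in> happy_in I V c'" using aC[OF xC] xC C_subset by (auto simp: happy_in_def)
    qed
    have disj: "dropped 0 \<inter> dropped (int a) = {}"
      using a by (auto simp: dropped_def unmarked_def)
    have "x \<notin> R" if "x \<in> dropped t" "t \<in> ?T" for x t
      using that dropped_iff[of x] dropped_subset[of t] by auto
    then have disj': "?H \<inter> (dropped 0 \<union> dropped (int a)) = {}" by (auto simp: happy_in_def)
    have "card (?H \<union> (dropped 0 \<union> dropped (int a))) = card ?H + (surplus I 0 + surplus I 1)"
      using disj disj' finite_kernel drop_0 drop_a
      by (simp add: card_Un_disjoint finite_dropped finite_happy)
    moreover have "card (?H \<union> (dropped 0 \<union> dropped (int a))) \<le> card (happy_in I V c')"
      by (rule card_mono[OF fin]) (use c'(2) dropped_happy in auto)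
    ultimately have "threshold I \<le> int (card (happy_in I V c'))" using c(2) threshold_R by linarith
    then show ?thesis using c'(1) by (auto simp: solvable_def)
  qed
qed

end

lemma mhv_yes_kernel: "mhv_yes (kernel I) \<longleftrightarrow> mhv_yes I"
proof -
  have "mhv_yes (kernel I) \<longleftrightarrow> solvable I (kernel_set I) (kernel_threshold I)"
    unfolding kernel_def by (rule mhv_yes_subinstance[OF wf kernel_set_subset])
  also have "\<dots> \<longleftrightarrow> solvable I V (threshold I)"
  proof (cases "int (kind_count I 0 + max_kind_count I) < threshold I")
    case True
    then show ?thesis using solvable_forward solvable_backward by blast
  next
    case False
    then show ?thesis
      using solvable_trivial[OF False] by (simp only: kernel_set_def kernel_threshold_def if_False)
  qed
  also have "\<dots> \<longleftrightarrow> mhv_yes I"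
    unfolding mhv_yes_iff_solvable[OF wf] verts_eq ..
  finally show ?thesis .
qed

text \<open>Every clique modulator meets all non-edges, so a minimum one is a cover to which the
  matching bound applies.\<close>

lemma card_modulator_le: "s \<le> 2 * dist_to_clique (graph I)"
proof -
  let ?P = "\<lambda>d. \<exists>T. clique_modulator (graph I) T \<and> card T = d"
  have "?P (card (verts (graph I)))"
    by (intro exI[of _ "verts (graph I)"]) (simp add: clique_modulator_def is_clique_def)
  then have "?P (dist_to_clique (graph I))" unfolding dist_to_clique_def by (rule LeastI)
  then obtain T where T: "clique_modulator (graph I) T" "card T = dist_to_clique (graph I)" by blast
  have "T \<subseteq> V" using T(1) by (simp add: clique_modulator_def verts_eq)
  then have "finite T" by (rule finite_subset) simp
  moreover have "u \<in> T \<or> v \<in> T" if "u < v" "v < nv I" "\<not> adj I u v" for u v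
  proof -
    have "u \<in> V" "v \<in> V" "u \<noteq> v" using that by auto
    then show ?thesis
      using T(1) that(3) unfolding clique_modulator_def is_clique_def verts_eq adj_def by blast
  qed
  ultimately show ?thesis
    unfolding modulator_def T(2)[symmetric] by (intro card_matched_le)
qed

lemma card_verts_kernel:
  assumes "d = dist_to_clique (graph I)"
  shows "card (verts (graph (kernel I))) \<le> 2 * d + (2 * d + 3) * (2 * d * (4 * d + 3) + 2)"
proof -
  have "s \<le> 2 * d" using card_modulator_le assms by simp
  then have "s + (s + 3) * slack I \<le> 2 * d + (2 * d + 3) * (2 * d * (2 * (2 * d) + 3) + 2)"
    unfolding slack_def by (intro add_mono mult_le_mono order.refl)
  then show ?thesis using card_kernel_set by (simp add: kernel_def)
qed

end

section \<open>Computing the kernel in polynomial time\<close>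

lemma nth_concat_uniform:
  assumes "\<And>xs. xs \<in> set xss \<Longrightarrow> length xs = n" "u < length xss" "v < n"
  shows "concat xss ! (u * n + v) = xss ! u ! v"
  using assms
proof (induction xss arbitrary: u)
  case (Cons xs xss)
  then show ?case by (cases u) (auto simp: nth_append algebra_simps)
qed simp

lemma length_concat_uniform:
  "(\<And>xs. xs \<in> set xss \<Longrightarrow> length xs = n) \<Longrightarrow> length (concat xss) = length xss * n"
  by (induction xss) auto

section \<open>Layout of the encoded input\<close>

context
  fixes I :: "nat mhv"
begin

abbreviation "rows \<equiv>
  map (\<lambda>u. map (\<lambda>v. if {u, v} \<in> edges (graph I) then 1 else 0) [0..<nv I]) [0..<nv I] :: int list list"

lemma encode_mhv_eq:
  "encode_mhv I = [int (nv I), int (num_colors I), threshold I]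
     @ map (\<lambda>v. int (pcol I v)) [0..<nv I] @ concat rows"
  by (auto simp: encode_mhv_def Let_def nv_def pcol_def split: option.split)

lemma length_encode: "length (encode_mhv I) = 3 + nv I + nv I * nv I"
proof -
  have "length (concat rows) = length rows * nv I" by (rule length_concat_uniform) auto
  then show ?thesis unfolding encode_mhv_eq by simp
qed

lemma encode_nth:
  "encode_mhv I ! 0 = int (nv I)"
  "encode_mhv I ! 1 = int (num_colors I)"
  "encode_mhv I ! 2 = threshold I"
  "v < nv I \<Longrightarrow> encode_mhv I ! (3 + v) = int (pcol I v)"
  by (simp_all add: encode_mhv_eq nth_append)

lemma encode_nth_adj:
  assumes "u < nv I" "v < nv I"
  shows "encode_mhv I ! (3 + nv I + (u * nv I + v)) = of_bool (adj I u v)"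
proof -
  have "encode_mhv I ! (3 + nv I + (u * nv I + v)) = concat rows ! (u * nv I + v)"
    unfolding encode_mhv_eq by (simp add: nth_append)
  also have "\<dots> = rows ! u ! v"
    by (rule nth_concat_uniform) (use assms in auto)
  finally show ?thesis using assms by (simp add: adj_def)
qed

definition inp :: "int \<Rightarrow> int" where "inp = array_of (encode_mhv I)"

text \<open>The offsets of the rows of the adjacency matrix are tabulated because the machine cannot
  multiply.\<close>

definition row_start :: "nat \<Rightarrow> int" where "row_start u = int (u * nv I)"

lemma array_of_nat: "m < length xs \<Longrightarrow> array_of xs (int m) = xs ! m"
  by (simp add: array_of_def)

lemma inp_simps [simp]:
  "inp 0 = int (nv I)" "inp 1 = int (num_colors I)" "inp 2 = threshold I"
  "v < nv I \<Longrightarrow> inp (3 + int v) = int (pcol I v)"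
  using array_of_nat[of 0 "encode_mhv I"] array_of_nat[of 1 "encode_mhv I"]
    array_of_nat[of 2 "encode_mhv I"] array_of_nat[of "3 + v" "encode_mhv I"]
  by (simp_all add: inp_def length_encode encode_nth[simplified])

lemma inp_adj [simp]:
  assumes "u < nv I" "v < nv I"
  shows "inp (3 + int (nv I) + row_start u + int v) = of_bool (adj I u v)"
proof -
  have "u * nv I + v < nv I * nv I"
    using assms mult_le_mono1[of "Suc u" "nv I" "nv I"] by simp
  then show ?thesis
    using array_of_nat[of "3 + nv I + (u * nv I + v)" "encode_mhv I"] encode_nth_adj[OF assms]
    by (simp add: inp_def row_start_def length_encode add.assoc)
qed

end

lemma tab_1 [simp]: "tab 1 f 0 = f 0" "tab (Suc 0) f 0 = f 0"
  by (simp_all add: tab_def)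

lemma array_of_eq_tab: "array_of xs = tab (length xs) (\<lambda>j. xs ! j)"
  by (auto simp: array_of_def tab_def)

definition stage :: "nat mhv \<Rightarrow> (int \<Rightarrow> int) list" where
  "stage I =
     [inp I,
      tab (nv I) (row_start I),
      tab (nv I) (\<lambda>v. int (partner (adj I) v)),
      tab (nv I) (\<lambda>v. of_bool (v \<in> modulator I)),
      tab (nv I) (kind I),
      tab (nv I) (\<lambda>v. int (key I v)),
      tab 1 (\<lambda>_. int (card (modulator I))),
      tab (nv I) (\<lambda>x. of_bool (marked I x)),
      tab 1 (\<lambda>_. int (slack I)),
      tab (nv I) (\<lambda>v. int (kind_count I (kind I v))),
      tab 1 (\<lambda>_. int (kind_count I 0)),
      tab 1 (\<lambda>_. int (max_kind_count I)),
      tab (nv I) (\<lambda>x. of_bool (x \<in> kernel_set I)),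
      tab (nv I) (\<lambda>x. int (rk (kernel_set I) x)),
      tab 1 (\<lambda>_. int (card (kernel_set I))),
      tab (nv I) (\<lambda>x. int (rk (kernel_set I) x * card (kernel_set I))),
      tab 1 (\<lambda>_. kernel_threshold I),
      tab (length (encode_mhv (kernel I))) (\<lambda>j. encode_mhv (kernel I) ! j)]"

lemma length_stage: "length (stage I) = 18"
  by (simp add: stage_def)

lemma stage_nth [simp]:
  "stage I ! 0 = inp I"
  "stage I ! Suc 0 = tab (nv I) (row_start I)"
  "stage I ! 2 = tab (nv I) (\<lambda>v. int (partner (adj I) v))"
  "stage I ! 3 = tab (nv I) (\<lambda>v. of_bool (v \<in> modulator I))"
  "stage I ! 4 = tab (nv I) (kind I)"
  "stage I ! 5 = tab (nv I) (\<lambda>v. int (key I v))"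
  "stage I ! 6 = tab (Suc 0) (\<lambda>_. int (card (modulator I)))"
  "stage I ! 7 = tab (nv I) (\<lambda>x. of_bool (marked I x))"
  "stage I ! 8 = tab (Suc 0) (\<lambda>_. int (slack I))"
  "stage I ! 9 = tab (nv I) (\<lambda>v. int (kind_count I (kind I v)))"
  "stage I ! 10 = tab (Suc 0) (\<lambda>_. int (kind_count I 0))"
  "stage I ! 11 = tab (Suc 0) (\<lambda>_. int (max_kind_count I))"
  "stage I ! 12 = tab (nv I) (\<lambda>x. of_bool (x \<in> kernel_set I))"
  "stage I ! 13 = tab (nv I) (\<lambda>x. int (rk (kernel_set I) x))"
  "stage I ! 14 = tab (Suc 0) (\<lambda>_. int (card (kernel_set I)))"
  "stage I ! 15 = tab (nv I) (\<lambda>x. int (rk (kernel_set I) x * card (kernel_set I)))"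
  "stage I ! 16 = tab (Suc 0) (\<lambda>_. kernel_threshold I)"
  "stage I ! 17 = tab (length (encode_mhv (kernel I))) (\<lambda>j. encode_mhv (kernel I) ! j)"
  by (simp_all add: stage_def)

lemma look_stage:
  "k < 18 \<Longrightarrow> look (take k (stage I) @ [g]) a = (if a < k then stage I ! a else if a = k then g else (\<lambda>_. 0))"
  by (auto simp: look_def nth_append length_stage)

lemma look_stage': "k < 18 \<Longrightarrow> look (take k (stage I)) a = (if a < k then stage I ! a else (\<lambda>_. 0))"
  by (auto simp: look_def length_stage)

lemma holds_Ite [simp]:
  "holds (Ite b t u) A e \<longleftrightarrow> (if holds b A e then holds t A e else holds u A e)"
  by (simp add: holds_def)

lemma reach_stage:
  assumes k: "0 < k" "k < 18" "k' = Suc k"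
    and B: "\<And>I. I \<in> D \<Longrightarrow> B I \<le> poly qb (nv I)"
    and b: "\<And>I e. I \<in> D \<Longrightarrow> sem b (look (take k (stage I))) e = int (B I)"
    and stage: "\<And>I. I \<in> D \<Longrightarrow> stage I ! k = tab (B I) (f I)"
    and t: "\<And>I j e. I \<in> D \<Longrightarrow> j < B I \<Longrightarrow>
        sem t (look (take k (stage I) @ [tab j (f I)])) (e(0 := int j)) = f I j"
  shows "reach D nv (\<lambda>I. take k (stage I)) (\<lambda>I. take k' (stage I))"
proof -
  have "reach D nv (\<lambda>I. take k (stage I)) (\<lambda>I. take k (stage I) @ [tab (B I) (f I)])"
  proof (rule reach_append[OF _ _ _ b B t])
    show "length (take k (stage I)) = k" for I using k by (simp add: length_stage)
    show "look (take k (stage I)) 0 0 = int (nv I)" for I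
      using k by (simp add: look_stage')
  qed (use k in simp)
  moreover have "take k (stage I) @ [tab (B I) (f I)] = take (Suc k) (stage I)" if "I \<in> D" for I
    using k stage[OF that] by (simp add: take_Suc_conv_app_nth length_stage)
  ultimately show ?thesis unfolding reach_def k(3) by simp
qed

abbreviation tn :: tm where "tn \<equiv> Get 0 (Num 0)"

lemma sem_tn: "0 < k \<Longrightarrow> k < 18 \<Longrightarrow> sem tn (look (take k (stage I))) e = int (nv I)"
  by (simp add: look_stage')

lemma reach_stage_verts:
  assumes "0 < k" "k < 18" "k' = Suc k"
    and "\<And>I. I \<in> D \<Longrightarrow> stage I ! k = tab (nv I) (f I)"
    and "\<And>I j e. I \<in> D \<Longrightarrow> j < nv I \<Longrightarrow>
        sem t (look (take k (stage I) @ [tab j (f I)])) (e(0 := int j)) = f I j"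
  shows "reach D nv (\<lambda>I. take k (stage I)) (\<lambda>I. take k' (stage I))"
  using assms by (intro reach_stage[where B = nv and qb = "[:0, 1:]" and b = tn and t = t and f = f] sem_tn) auto

lemma reach_stage_const:
  assumes "0 < k" "k < 18" "k' = Suc k"
    and "\<And>I. I \<in> D \<Longrightarrow> stage I ! k = tab 1 (\<lambda>_. f I)"
    and "\<And>I e. I \<in> D \<Longrightarrow>
        sem t (look (take k (stage I) @ [tab 0 (\<lambda>_. f I)])) (e(0 := 0)) = f I"
  shows "reach D nv (\<lambda>I. take k (stage I)) (\<lambda>I. take k' (stage I))"
  using assms by (intro reach_stage[where B = "\<lambda>_. 1" and qb = "[:1:]" and b = "Num 1" and t = t and f = "\<lambda>I _. f I"]) auto

text \<open>Conditions are simplified as formulas through \<open>holds\<close>. The congruence rules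
  pass on guards such as \<open>u < v\<close>, under which lookups in partly filled tables can be
  evaluated.\<close>

declare sem.simps(6) [simp del] sem_Ite [simp] if_cong [cong] conj_cong [cong]

abbreviation tk :: tm where "tk \<equiv> Get 0 (Num 2)"
abbreviation tcol :: "nat \<Rightarrow> tm" where "tcol i \<equiv> Get 0 (Add (Num 3) (Var i))"
abbreviation tadj :: "nat \<Rightarrow> nat \<Rightarrow> tm" where
  "tadj i j \<equiv> Get 0 (Add (Add (Add (Num 3) tn) (Get 1 (Var i))) (Var j))"
abbreviation tcadj :: "nat \<Rightarrow> nat \<Rightarrow> tm" where "tcadj i j \<equiv> TOr (TEq (Var i) (Var j)) (tadj i j)"
abbreviation tget :: "nat \<Rightarrow> nat \<Rightarrow> tm" where "tget a i \<equiv> Get a (Var i)"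
abbreviation tconst :: "nat \<Rightarrow> tm" where "tconst a \<equiv> Get a (Num 0)"
abbreviation trest :: "nat \<Rightarrow> tm" where "trest i \<equiv> TNot (tget 3 i)"

text \<open>Replaces multiplication: one factor is the number of indices that satisfy the
  condition.\<close>

lemma sum_if_const:
  fixes n :: nat
  shows "(\<Sum>j<n. if P j then c else 0) = int (card {j. j < n \<and> P j}) * c"
  by (subst sum.If_cases) (auto simp: lessThan_def Collect_conj_eq)

text \<open>A least element as a sum in which just one index contributes. The summand
  \<open>1 + int u\<close> fits the values \<open>Suc u\<close> of \<open>partner\<close>.\<close>

lemma sum_if_first:
  fixes n :: nat
  assumes "\<And>u. P u \<Longrightarrow> u < n"
  shows "(\<Sum>u<n. if P u \<and> \<not> (\<exists>w<n. w < u \<and> P w) then 1 + int u else 0) =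
    int (if Ex P then Suc (LEAST u. P u) else 0)"
proof (cases "Ex P")
  case True
  then have P: "P (Least P)" by (rule LeastI_ex)
  have first: "P u \<and> \<not> (\<exists>w<n. w < u \<and> P w) \<longleftrightarrow> u = Least P"
    for u
    using P assms Least_le[of P u] not_less_Least[of _ P] by (metis le_neq_implies_less)
  then have "(\<Sum>u<n. if P u \<and> \<not> (\<exists>w<n. w < u \<and> P w) then 1 + int u else 0) =
      (\<Sum>u<n. if u = Least P then 1 + int u else 0)"
    by (simp only: first)
  also have "\<dots> = 1 + int (Least P)" using assms[OF P] by (simp add: sum.delta)
  finally show ?thesis using True by simp
qed simp

lemma phase_row_start: "reach mhv_instances nv (\<lambda>I. take 1 (stage I)) (\<lambda>I. take 2 (stage I))"
proof (rule reach_stage_verts[where t = "Sum 1 (Ite (TLt (Var 1) (Var 0)) tn (Num 0))" and f = row_start])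
  fix I j and e :: "nat \<Rightarrow> int" assume "I \<in> mhv_instances" "j < nv I"
  then have "{i. i < nv I \<and> i < j} = {..<j}" by auto
  then show "sem (Sum 1 (Ite (TLt (Var 1) (Var 0)) tn (Num 0)))
      (look (take 1 (stage I) @ [tab j (row_start I)])) (e(0 := int j)) = row_start I j"
    by (simp add: look_stage sum_if_const row_start_def)
qed simp_all

definition tfree :: "nat \<Rightarrow> nat \<Rightarrow> tm" where
  "tfree i w = TAnd (TLt (Var i) (Var 0)) (TAnd (TNot (tadj i 0)) (TAnd (TNot (tget 2 i))
     (TNot (TCard w (TEq (tget 2 w) (Add (Num 1) (Var i)))))))"

definition tpartner :: tm where
  "tpartner = Sum 1 (Ite (TAnd (tfree 1 3) (TNot (TCard 2 (TAnd (TLt (Var 2) (Var 1)) (tfree 2 3)))))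
     (Add (Num 1) (Var 1)) (Num 0))"

lemma phase_partner: "reach mhv_instances nv (\<lambda>I. take 2 (stage I)) (\<lambda>I. take 3 (stage I))"
proof (rule reach_stage_verts[where t = tpartner and f = "\<lambda>I v. int (partner (adj I) v)"])
  fix I j and e :: "nat \<Rightarrow> int" assume I: "I \<in> mhv_instances" and j: "j < nv I"
  let ?A = "look (take 2 (stage I) @ [tab j (\<lambda>v. int (partner (adj I) v))])"
  let ?P = "\<lambda>u. u < j \<and> \<not> adj I u j \<and> partner (adj I) u = 0 \<and> \<not> (\<exists>w. w < j \<and> partner (adj I) w = Suc u)"
  have one: "1 + int u = int (Suc u)" for u by simp
  have free: "holds (tfree i w) ?A f \<longleftrightarrow> ?P u"
    if "u < nv I" "f 0 = int j" "f i = int u" "w \<noteq> i" "w \<noteq> 0" "i \<noteq> 0" for i w f u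
    using that j by (auto simp: tfree_def look_stage one simp del: of_nat_Suc split: if_splits)
  have "sem tpartner ?A (e(0 := int j)) =
      (\<Sum>u<nv I. if ?P u \<and> \<not> (\<exists>w<nv I. w < u \<and> ?P w) then 1 + int u else 0)"
    unfolding tpartner_def using j
    by (auto simp: look_stage free intro!: sum.cong)
  also have "\<dots> = int (if Ex ?P then Suc (LEAST u. ?P u) else 0)"
    by (rule sum_if_first) (use j in auto)
  also have "\<dots> = int (partner (adj I) j)"
    by (subst (4) partner.simps) simp
  finally show "sem tpartner ?A (e(0 := int j)) = int (partner (adj I) j)" .
qed simp_all

lemma phase_modulator: "reach mhv_instances nv (\<lambda>I. take 3 (stage I)) (\<lambda>I. take 4 (stage I))"
proof (rule reach_stage_verts[where f = "\<lambda>I v. of_bool (v \<in> modulator I)" and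
      t = "TBool (TOr (tget 2 0) (TCard 1 (TEq (tget 2 1) (Add (Num 1) (Var 0)))))"])
  have one: "1 + int u = int (Suc u)" for u by simp
  show "sem (TBool (TOr (tget 2 0) (TCard 1 (TEq (tget 2 1) (Add (Num 1) (Var 0))))))
      (look (take 3 (stage I) @ [tab j (\<lambda>v. of_bool (v \<in> modulator I))])) (e(0 := int j)) = of_bool (j \<in> modulator I)"
    if "I \<in> mhv_instances" "j < nv I" for I j e
    using that
    by (simp add: look_stage modulator_def matched_def one del: of_nat_Suc)
qed simp_all

definition tconflicting :: tm where
  "tconflicting =
     TCard 1 (TCard 2 (TAnd (tcadj 0 1) (TAnd (tcadj 0 2) (TAnd (tcol 1) (TLt (tcol 1) (tcol 2))))))"

definition tkind :: tm where
  "tkind = Ite tconflicting (Num (- 1))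
     (Sum 1 (Ite (TAnd (tcadj 0 1) (TAnd (tcol 1)
        (TNot (TCard 2 (TAnd (TLt (Var 2) (Var 1)) (TAnd (tcadj 0 2) (tcol 2))))))) (tcol 1) (Num 0)))"

lemma phase_kind: "reach mhv_instances nv (\<lambda>I. take 4 (stage I)) (\<lambda>I. take 5 (stage I))"
proof (rule reach_stage_verts[where f = kind and t = tkind])
  fix I j and e :: "nat \<Rightarrow> int" assume "I \<in> mhv_instances" and j: "j < nv I"
  let ?A = "look (take 4 (stage I) @ [tab j (kind I)])"
  have "holds tconflicting ?A (e(0 := int j)) \<longleftrightarrow> conflicting I j"
    using j by (simp add: tconflicting_def look_stage conflicting_def cadj_def)
  then show "sem tkind ?A (e(0 := int j)) = kind I j"
    using j by (simp add: tkind_def look_stage kind_def first_colored_def cadj_def cong: sum.cong_simp)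
qed simp_all

text \<open>The product with \<open>nv I\<close> is obtained by summing the precolour once per
  vertex.\<close>

lemma phase_key: "reach mhv_instances nv (\<lambda>I. take 5 (stage I)) (\<lambda>I. take 6 (stage I))"
proof (rule reach_stage_verts[where f = "\<lambda>I v. int (key I v)" and t = "Add (Sum 1 (tcol 0)) (Var 0)"])
  fix I j and e :: "nat \<Rightarrow> int" assume "I \<in> mhv_instances" "j < nv I"
  then show "sem (Add (Sum 1 (tcol 0)) (Var 0))
      (look (take 5 (stage I) @ [tab j (\<lambda>v. int (key I v))])) (e(0 := int j)) = int (key I j)"
    by (simp add: look_stage key_def)
qed simp_all

lemma modulator_less: "v \<in> modulator I \<Longrightarrow> v < nv I"
  by (simp add: modulator_def matched_def)

lemma Collect_modulator: "{v. v < nv I \<and> v \<in> modulator I} = modulator I"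
  using modulator_less by auto

lemma Bex_modulator: "(\<exists>v\<in>modulator I. P v) \<longleftrightarrow> (\<exists>v<nv I. v \<in> modulator I \<and> P v)"
  using modulator_less by auto

lemma Bex_rest: "(\<exists>v\<in>rest I. P v) \<longleftrightarrow> (\<exists>v<nv I. v \<notin> modulator I \<and> P v)"
  by (auto simp: rest_def)

lemma mem_rest: "v \<in> rest I \<longleftrightarrow> v < nv I \<and> v \<notin> modulator I"
  by (simp add: rest_def)

lemma phase_card_modulator: "reach mhv_instances nv (\<lambda>I. take 6 (stage I)) (\<lambda>I. take 7 (stage I))"
proof (rule reach_stage_const[where f = "\<lambda>I. int (card (modulator I))" and t = "TCard 1 (tget 3 1)"])
  show "sem (TCard 1 (tget 3 1)) (look (take 6 (stage I) @ [tab 0 (\<lambda>_. int (card (modulator I)))])) (e(0 := 0))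
      = int (card (modulator I))" for I e
    by (simp add: look_stage Collect_modulator)
qed simp_all

definition tcommon :: tm where
  "tcommon = TCard 1 (TAnd (tget 3 1) (TCard 2 (TAnd (tget 3 2) (TAnd (tadj 1 0) (TAnd (tadj 2 0)
     (TNot (TCard 3 (TAnd (trest 3) (TAnd (TLt (Var 3) (Var 0)) (TAnd (tadj 1 3) (tadj 2 3)))))))))))"

definition tcolor :: tm where
  "tcolor = TAnd (tcol 0) (TCard 1 (TAnd (tcadj 1 0) (TOr
     (TNot (TCard 2 (TAnd (trest 2) (TAnd (tcadj 1 2) (TAnd (tcol 2) (TLt (tget 5 2) (tget 5 0)))))))
     (TNot (TCard 2 (TAnd (trest 2) (TAnd (tcadj 1 2) (TAnd (tcol 2) (TLt (tget 5 0) (tget 5 2))))))))))"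

definition tdegree :: tm where
  "tdegree = TCard 1 (TAnd (tget 3 1) (TAnd (tadj 1 0) (TLt
     (TCard 2 (TAnd (trest 2) (TAnd (TEq (tget 4 2) (tget 4 0)) (TAnd (tadj 1 2) (TLt (Var 2) (Var 0))))))
     (tconst 6))))"

lemma phase_marked: "reach mhv_instances nv (\<lambda>I. take 7 (stage I)) (\<lambda>I. take 8 (stage I))"
proof (rule reach_stage_verts[where f = "\<lambda>I x. of_bool (marked I x)" and
      t = "TBool (TOr tcommon (TOr tcolor tdegree))"])
  fix I j and e :: "nat \<Rightarrow> int" assume "I \<in> mhv_instances" and j: "j < nv I"
  let ?A = "look (take 7 (stage I) @ [tab j (\<lambda>x. of_bool (marked I x))])" and ?e = "e(0 := int j)"
  have "holds tcommon ?A ?e \<longleftrightarrow> common_mark I j"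
    unfolding common_mark_def Bex_modulator Bex_rest using j by (simp add: tcommon_def look_stage)
  moreover have "holds tcolor ?A ?e \<longleftrightarrow> color_mark I j"
    unfolding color_mark_def Bex_modulator Bex_rest using j by (simp add: tcolor_def look_stage cadj_def)
  moreover have "holds tdegree ?A ?e \<longleftrightarrow> degree_mark I j"
    unfolding degree_mark_def Bex_modulator rk_def mem_Collect_eq mem_rest conj_assoc
    using j by (simp add: tdegree_def look_stage)
  ultimately show "sem (TBool (TOr tcommon (TOr tcolor tdegree))) ?A ?e = of_bool (marked I j)"
    by (simp add: marked_def)
qed simp_all

definition tslack :: tm where
  "tslack = Add (Num 2) (Sum 1 (Ite (tget 3 1) (Add (Num 3) (Add (tconst 6) (tconst 6))) (Num 0)))"

lemma phase_slack: "reach mhv_instances nv (\<lambda>I. take 8 (stage I)) (\<lambda>I. take 9 (stage I))"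
proof (rule reach_stage_const[where f = "\<lambda>I. int (slack I)" and t = tslack])
  show "sem tslack (look (take 8 (stage I) @ [tab 0 (\<lambda>_. int (slack I))])) (e(0 := 0)) = int (slack I)" for I e
    by (simp add: tslack_def look_stage sum_if_const Collect_modulator slack_def algebra_simps)
qed simp_all

lemma kind_count_alt: "kind_count I t = card {v. v < nv I \<and> v \<notin> modulator I \<and> kind I v = t}"
  unfolding kind_count_def mem_rest conj_assoc ..

lemma phase_kind_count: "reach mhv_instances nv (\<lambda>I. take 9 (stage I)) (\<lambda>I. take 10 (stage I))"
proof (rule reach_stage_verts[where f = "\<lambda>I v. int (kind_count I (kind I v))" and
      t = "TCard 1 (TAnd (trest 1) (TEq (tget 4 1) (tget 4 0)))"])
  show "sem (TCard 1 (TAnd (trest 1) (TEq (tget 4 1) (tget 4 0))))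
      (look (take 9 (stage I) @ [tab j (\<lambda>v. int (kind_count I (kind I v)))])) (e(0 := int j)) = int (kind_count I (kind I j))"
    if "j < nv I" for I j e
    using that by (simp add: look_stage kind_count_alt)
qed simp_all

lemma phase_kind_count_0: "reach mhv_instances nv (\<lambda>I. take 10 (stage I)) (\<lambda>I. take 11 (stage I))"
proof (rule reach_stage_const[where f = "\<lambda>I. int (kind_count I 0)" and
      t = "TCard 1 (TAnd (trest 1) (TEq (tget 4 1) (Num 0)))"])
  show "sem (TCard 1 (TAnd (trest 1) (TEq (tget 4 1) (Num 0))))
      (look (take 10 (stage I) @ [tab 0 (\<lambda>_. int (kind_count I 0))])) (e(0 := 0)) = int (kind_count I 0)" for I e
    by (simp add: look_stage kind_count_alt)
qed simp_all

text \<open>A maximum is the number of naturals below it, and being below it means being below one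
  of the counts. The counts are at most \<open>nv I\<close>, so the range of the sums
  suffices.\<close>

lemma max_kind_count_eq_card: "max_kind_count I = card {i. i < nv I \<and> (\<exists>v<nv I. v \<notin> modulator I \<and> 0 < kind I v \<and> i < kind_count I (kind I v))}"
proof -
  let ?A = "(\<lambda>v. kind_count I (kind I v)) ` {v \<in> rest I. 0 < kind I v}"
  have fin: "finite (rest I)" by (simp add: rest_def)
  have le: "kind_count I t \<le> nv I" for t
    unfolding kind_count_alt by (rule order.trans[OF card_mono[of "{..<nv I}"]]) auto
  have less: "i < max_kind_count I \<longleftrightarrow> (\<exists>v<nv I. v \<notin> modulator I \<and> 0 < kind I v \<and> i < kind_count I (kind I v))" for i
    unfolding max_kind_count_def using fin by (subst Max_gr_iff) (auto simp: rest_def)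
  have "i < nv I" if "i < max_kind_count I" for i
    using that le less[of i] by (meson less_le_trans)
  then have "{i. i < nv I \<and> (\<exists>v<nv I. v \<notin> modulator I \<and> 0 < kind I v \<and> i < kind_count I (kind I v))} = {..<max_kind_count I}"
    unfolding less[symmetric] by auto
  then show ?thesis by (simp only: card_lessThan)
qed

definition tqmax :: tm where
  "tqmax = TCard 1 (TCard 2 (TAnd (trest 2) (TAnd (TLt (Num 0) (tget 4 2)) (TLt (Var 1) (tget 9 2)))))"

lemma phase_max_kind_count: "reach mhv_instances nv (\<lambda>I. take 11 (stage I)) (\<lambda>I. take 12 (stage I))"
proof (rule reach_stage_const[where f = "\<lambda>I. int (max_kind_count I)" and t = tqmax])
  show "sem tqmax (look (take 11 (stage I) @ [tab 0 (\<lambda>_. int (max_kind_count I))])) (e(0 := 0)) = int (max_kind_count I)" for I e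
    unfolding max_kind_count_eq_card by (simp add: tqmax_def look_stage)
qed simp_all

definition tlarge :: tm where
  "tlarge = TLt (Add (tconst 10) (tconst 11)) tk"

definition trank :: tm where
  "trank = TCard 1 (TAnd (trest 1) (TAnd (TNot (tget 7 1)) (TAnd (TEq (tget 4 1) (tget 4 0)) (TLt (Var 1) (Var 0)))))"

definition tkept :: tm where
  "tkept = Ite tlarge
     (TOr (tget 3 0) (TOr (tget 7 0) (TAnd (TNot (TLt (tget 4 0) (Num 0)))
        (TNot (TLt (Add trank (tconst 8)) (Ite (TEq (tget 4 0) (Num 0)) (tconst 10) (tconst 11)))))))
     (TEq (Var 0) (Num 0))"

lemma phase_kernel_set: "reach mhv_instances nv (\<lambda>I. take 12 (stage I)) (\<lambda>I. take 13 (stage I))"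
proof (rule reach_stage_verts[where f = "\<lambda>I x. of_bool (x \<in> kernel_set I)" and t = "TBool tkept"])
  fix I j and e :: "nat \<Rightarrow> int" assume "I \<in> mhv_instances" and j: "j < nv I"
  let ?A = "look (take 12 (stage I) @ [tab j (\<lambda>x. of_bool (x \<in> kernel_set I))])" and ?e = "e(0 := int j)"
  have rank: "sem trank ?A ?e = int (rk (unmarked I (kind I j)) j)"
    unfolding rk_def unmarked_def mem_Collect_eq mem_rest conj_assoc using j
    by (simp add: trank_def look_stage)
  have large: "holds tlarge ?A ?e \<longleftrightarrow> int (kind_count I 0 + max_kind_count I) < threshold I"
    by (simp add: tlarge_def look_stage)
  \<comment> \<open>Moving \<open>slack I\<close> to the other side removes the truncated
    subtraction, since terms compute with integers.\<close>
  have sur: "surplus I t \<le> r \<longleftrightarrow> \<not> int r + int (slack I) < int (if t = 0 then kind_count I 0 else max_kind_count I)" for t r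
    by (auto simp: surplus_def)
  have "j \<in> kernel_set I \<longleftrightarrow> (if int (kind_count I 0 + max_kind_count I) < threshold I
      then j \<in> modulator I \<or> marked I j \<or> 0 \<le> kind I j \<and> surplus I (kind I j) \<le> rk (unmarked I (kind I j)) j
      else j = 0)"
    using j by (auto simp: kernel_set_def mem_rest)
  moreover have "holds tkept ?A ?e \<longleftrightarrow> (if int (kind_count I 0 + max_kind_count I) < threshold I
      then j \<in> modulator I \<or> marked I j \<or> 0 \<le> kind I j \<and> surplus I (kind I j) \<le> rk (unmarked I (kind I j)) j
      else j = 0)"
    unfolding sur tkept_def using j by (simp add: look_stage rank large not_less)
  ultimately have "holds tkept ?A ?e \<longleftrightarrow> j \<in> kernel_set I" by simp
  then show "sem (TBool tkept) ?A ?e = of_bool (j \<in> kernel_set I)" by simp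
qed simp_all

lemma kernel_set_less: "x \<in> kernel_set I \<Longrightarrow> x < nv I"
  by (auto simp: kernel_set_def mem_rest modulator_less split: if_splits)

lemma finite_kernel_set: "finite (kernel_set I)"
  by (rule finite_subset[of _ "{..<nv I}"]) (auto dest: kernel_set_less)

lemma Collect_kernel_set: "{x. x < nv I \<and> x \<in> kernel_set I} = kernel_set I"
  using kernel_set_less by auto

lemma card_kernel_set_le: "card (kernel_set I) \<le> nv I"
  using card_mono[of "{..<nv I}" "kernel_set I"] kernel_set_less by fastforce

lemma rk_kernel_set: "rk (kernel_set I) x = card {y. y < nv I \<and> y \<in> kernel_set I \<and> y < x}"
  unfolding rk_def by (rule arg_cong[where f = card]) (auto dest: kernel_set_less)

lemma rk_kernel_set_le: "rk (kernel_set I) x \<le> nv I"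
  unfolding rk_kernel_set by (rule order.trans[OF card_mono[of "{..<nv I}"]]) auto

lemma phase_rk: "reach mhv_instances nv (\<lambda>I. take 13 (stage I)) (\<lambda>I. take 14 (stage I))"
proof (rule reach_stage_verts[where f = "\<lambda>I x. int (rk (kernel_set I) x)" and
      t = "TCard 1 (TAnd (tget 12 1) (TLt (Var 1) (Var 0)))"])
  show "sem (TCard 1 (TAnd (tget 12 1) (TLt (Var 1) (Var 0))))
      (look (take 13 (stage I) @ [tab j (\<lambda>x. int (rk (kernel_set I) x))])) (e(0 := int j)) = int (rk (kernel_set I) j)"
    for I j e by (simp add: look_stage rk_kernel_set)
qed simp_all

lemma phase_card_kernel_set: "reach mhv_instances nv (\<lambda>I. take 14 (stage I)) (\<lambda>I. take 15 (stage I))"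
proof (rule reach_stage_const[where f = "\<lambda>I. int (card (kernel_set I))" and t = "TCard 1 (tget 12 1)"])
  show "sem (TCard 1 (tget 12 1)) (look (take 14 (stage I) @ [tab 0 (\<lambda>_. int (card (kernel_set I)))])) (e(0 := 0))
      = int (card (kernel_set I))" for I e
    by (simp add: look_stage Collect_kernel_set)
qed simp_all

lemma phase_row_offset: "reach mhv_instances nv (\<lambda>I. take 15 (stage I)) (\<lambda>I. take 16 (stage I))"
proof (rule reach_stage_verts[where f = "\<lambda>I x. int (rk (kernel_set I) x * card (kernel_set I))" and
      t = "Sum 1 (Ite (TLt (Var 1) (tget 13 0)) (tconst 14) (Num 0))"])
  fix I j and e :: "nat \<Rightarrow> int" assume j: "j < nv I"
  have "{i. i < nv I \<and> i < rk (kernel_set I) j} = {..<rk (kernel_set I) j}"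
    using rk_kernel_set_le[of I j] by auto
  then show "sem (Sum 1 (Ite (TLt (Var 1) (tget 13 0)) (tconst 14) (Num 0)))
      (look (take 15 (stage I) @ [tab j (\<lambda>x. int (rk (kernel_set I) x * card (kernel_set I)))])) (e(0 := int j))
      = int (rk (kernel_set I) j * card (kernel_set I))"
    using j by (simp add: look_stage sum_if_const)
qed simp_all

definition ttrunc :: "tm \<Rightarrow> tm" where
  "ttrunc q = Ite (TLt (tconst 8) q) (Sub q (tconst 8)) (Num 0)"

lemma phase_threshold: "reach mhv_instances nv (\<lambda>I. take 16 (stage I)) (\<lambda>I. take 17 (stage I))"
proof (rule reach_stage_const[where f = kernel_threshold and
      t = "Ite tlarge (Sub (Sub tk (ttrunc (tconst 10))) (ttrunc (tconst 11))) (Num 0)"])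
  fix I and e :: "nat \<Rightarrow> int"
  let ?A = "look (take 16 (stage I) @ [tab 0 (\<lambda>_. kernel_threshold I)])" and ?e = "e(0 := 0)"
  have "sem (ttrunc (tconst 10)) ?A ?e = int (surplus I 0)" "sem (ttrunc (tconst 11)) ?A ?e = int (surplus I 1)"
    by (auto simp: ttrunc_def look_stage surplus_def)
  then show "sem (Ite tlarge (Sub (Sub tk (ttrunc (tconst 10))) (ttrunc (tconst 11))) (Num 0)) ?A ?e = kernel_threshold I"
    by (simp add: tlarge_def look_stage kernel_threshold_def)
qed simp_all

section \<open>Writing out the kernel\<close>

definition tlength :: tm where
  "tlength = Add (Num 3) (Add (tconst 14) (Sum 1 (Ite (tget 12 1) (tconst 14) (Num 0))))"

text \<open>An output cell refers to a kernel vertex by its rank. The inverse of \<open>rk\<close>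
  is not tabulated, so the sum searches for the vertex of that rank.\<close>

definition tcolors_out :: tm where
  "tcolors_out = Sum 1 (Ite (TAnd (tget 12 1) (TEq (Add (Num 3) (tget 13 1)) (Var 0))) (tcol 1) (Num 0))"

definition tedges_out :: tm where
  "tedges_out = TCard 1 (TCard 2 (TAnd (tget 12 1) (TAnd (tget 12 2) (TAnd
     (TEq (Add (Add (Add (Num 3) (tconst 14)) (tget 15 1)) (tget 13 2)) (Var 0)) (tadj 1 2)))))"

definition tout :: tm where
  "tout = Ite (TLt (Var 0) (Num 1)) (tconst 14)
    (Ite (TLt (Var 0) (Num 2)) (Get 0 (Num 1))
    (Ite (TLt (Var 0) (Num 3)) (tconst 16)
    (Ite (TLt (Var 0) (Add (Num 3) (tconst 14))) tcolors_out (TBool tedges_out))))"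

lemma nv_kernel: "nv (kernel I) = card (kernel_set I)"
  by (simp add: nv_def kernel_def)

lemma length_encode_kernel_le: "length (encode_mhv (kernel I)) \<le> poly [:3, 1, 1:] (nv I)"
proof -
  have "card (kernel_set I) * card (kernel_set I) \<le> nv I * nv I"
    by (intro mult_le_mono card_kernel_set_le)
  then show ?thesis
    using card_kernel_set_le[of I] by (simp add: length_encode nv_kernel algebra_simps)
qed

lemma phase_output: "reach mhv_instances nv (\<lambda>I. take 17 (stage I)) (\<lambda>I. take 18 (stage I))"
proof (rule reach_stage[where f = "\<lambda>I j. encode_mhv (kernel I) ! j" and t = tout and b = tlength and
      B = "\<lambda>I. length (encode_mhv (kernel I))" and qb = "[:3, 1, 1:]"])
  show "length (encode_mhv (kernel I)) \<le> poly [:3, 1, 1:] (nv I)" for I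
    by (rule length_encode_kernel_le)
  show "sem tlength (look (take 17 (stage I))) e = int (length (encode_mhv (kernel I)))" for I e
    by (simp add: tlength_def look_stage' sum_if_const Collect_kernel_set length_encode nv_kernel)
next
  fix I j and e :: "nat \<Rightarrow> int" assume I: "I \<in> mhv_instances" and j: "j < length (encode_mhv (kernel I))"
  interpret kernelization I by unfold_locales (rule I)
  let ?K = "kernel_set I" and ?J = "kernel I"
  let ?A = "look (take 17 (stage I) @ [tab j (\<lambda>j. encode_mhv ?J ! j)])" and ?e = "e(0 := int j)"
  let ?m = "card ?K"
  have im: "rk ?K ` ?K = {..<?m}" by (rule rk_image[OF finite_kernel_set])
  have rk_less: "rk ?K x < ?m" if "x \<in> ?K" for x
    by (rule rk_less_card[OF finite_kernel_set that])
  have rk_eq: "rk ?K x = rk ?K y \<longleftrightarrow> x = y" if "x \<in> ?K" "y \<in> ?K" for x y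
    using inj_on_eq_iff[OF inj_on_rk[OF finite_kernel_set] that] .
  have obt: "\<exists>x\<in>?K. v = rk ?K x" if "v < ?m" for v
    using that im by (metis imageE lessThan_iff)
  consider "j = 0" | "j = 1" | "j = 2" | v where "j = 3 + v" "v < ?m"
    | u v where "j = 3 + ?m + (u * ?m + v)" "u < ?m" "v < ?m"
  proof -
    have *: "\<exists>u v. j = 3 + ?m + (u * ?m + v) \<and> u < ?m \<and> v < ?m" if "3 + ?m \<le> j"
    proof -
      have "j - (3 + ?m) < ?m * ?m" using j that by (simp add: length_encode nv_kernel)
      moreover from this have "0 < ?m" by (cases "?m = 0") auto
      ultimately show ?thesis using that
        by (intro exI[of _ "(j - (3 + ?m)) div ?m"] exI[of _ "(j - (3 + ?m)) mod ?m"])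
          (simp add: less_mult_imp_div_less)
    qed
    have "j = 3 + (j - 3)" if "3 \<le> j" using that by simp
    then show ?thesis using that * by (metis (no_types, lifting) One_nat_def Suc_1 add_less_cancel_left
        less_Suc_eq linorder_not_less numeral_3_eq_3 not_less0)
  qed
  then show "sem tout ?A ?e = encode_mhv ?J ! j"
  proof cases
    case 1
    then show ?thesis by (simp add: tout_def look_stage encode_nth nv_kernel)
  next
    case 2
    then show ?thesis using encode_nth(2)[of ?J] by (simp add: tout_def look_stage kernel_def)
  next
    case 3
    then show ?thesis by (simp add: tout_def look_stage encode_nth kernel_def)
  next
    case (4 v)
    obtain x where x: "x \<in> ?K" "v = rk ?K x" using obt[OF 4(2)] by blast
    have eq: "3 + int (rk ?K y) = int j \<longleftrightarrow> rk ?K y = rk ?K x" for y using 4 x(2) by auto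
    have "sem tout ?A ?e = sem tcolors_out ?A ?e" using 4 by (simp add: tout_def look_stage)
    also have "\<dots> = (\<Sum>y<nv I. if y \<in> ?K \<and> y = x then int (pcol I y) else 0)"
      unfolding tcolors_out_def using rk_eq[OF _ x(1)] kernel_set_less[OF x(1)]
      by (simp add: look_stage eq)
    also have "\<dots> = (\<Sum>y<nv I. if y = x then int (pcol I y) else 0)"
      by (intro sum.cong) (use x(1) in auto)
    also have "\<dots> = int (pcol I x)" using kernel_set_less[OF x(1)] by (simp add: sum.delta)
    also have "\<dots> = int (pcol ?J v)"
      unfolding kernel_def x(2) by (simp add: pcol_subinstance[OF wf kernel_set_subset x(1)])
    also have "\<dots> = encode_mhv ?J ! j" using 4 by (simp add: encode_nth nv_kernel)
    finally show ?thesis .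
  next
    case (5 u v)
    obtain x where x: "x \<in> ?K" "u = rk ?K x" using obt[OF 5(2)] by blast
    obtain y where y: "y \<in> ?K" "v = rk ?K y" using obt[OF 5(3)] by blast
    have eq: "3 + int ?m + int (rk ?K z * ?m) + int (rk ?K w) = int j \<longleftrightarrow> z = x \<and> w = y"
      if "z \<in> ?K" "w \<in> ?K" for z w
    proof -
      have "3 + int ?m + int (rk ?K z * ?m) + int (rk ?K w) = int j \<longleftrightarrow> rk ?K z * ?m + rk ?K w = u * ?m + v"
        unfolding 5(1) by linarith
      also have "\<dots> \<longleftrightarrow> rk ?K z = u \<and> rk ?K w = v"
      proof
        assume *: "rk ?K z * ?m + rk ?K w = u * ?m + v"
        have "(rk ?K z * ?m + rk ?K w) div ?m = rk ?K z" using rk_less[OF that(2)] by simp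
        moreover have "(u * ?m + v) div ?m = u" using 5(3) by simp
        ultimately show "rk ?K z = u \<and> rk ?K w = v" using * by simp
      qed simp
      finally show ?thesis using rk_eq that x y by simp
    qed
    have "\<not> int j < 1" "\<not> int j < 2" "\<not> int j < 3" "\<not> int j < 3 + int ?m"
      using 5(1) by linarith+
    then have "sem tout ?A ?e = of_bool (holds tedges_out ?A ?e)"
      unfolding tout_def by (simp only: sem_Ite holds_simps) (simp add: look_stage)
    also have "holds tedges_out ?A ?e \<longleftrightarrow>
        (\<exists>z<nv I. \<exists>w<nv I. z \<in> ?K \<and> w \<in> ?K \<and>
           3 + int ?m + int (rk ?K z * ?m) + int (rk ?K w) = int j \<and> adj I z w)"
      unfolding tedges_out_def by (simp add: look_stage del: of_nat_mult)
    also have "\<dots> \<longleftrightarrow> adj I x y" using eq x(1) y(1) kernel_set_less by blast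
    also have "\<dots> \<longleftrightarrow> adj ?J u v"
      unfolding kernel_def x(2) y(2) by (simp add: adj_subinstance[OF wf kernel_set_subset x(1) y(1)])
    also have "of_bool (adj ?J u v) = encode_mhv ?J ! j"
      using encode_nth_adj[of u ?J v] 5 by (simp add: nv_kernel)
    finally show ?thesis .
  qed
qed simp_all

lemma polytime_kernel: "polytime_computable mhv_instances encode_mhv encode_mhv kernel"
proof (rule polytime_computableI[where n = nv and ys = "\<lambda>I. take 18 (stage I)" and q = "[:3, 1, 1:]"])
  have "(\<lambda>I. [array_of (encode_mhv I)]) = (\<lambda>I. take 1 (stage I))"
    by (auto simp: stage_def inp_def)
  then show "reach mhv_instances nv (\<lambda>I. [array_of (encode_mhv I)]) (\<lambda>I. take 18 (stage I))"
    using reach_trans[OF phase_row_start reach_trans[OF phase_partner reach_trans[OF phase_modulator reach_trans[OF phase_kind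
      reach_trans[OF phase_key reach_trans[OF phase_card_modulator reach_trans[OF phase_marked reach_trans[OF phase_slack
      reach_trans[OF phase_kind_count reach_trans[OF phase_kind_count_0 reach_trans[OF phase_max_kind_count reach_trans[OF phase_kernel_set
      reach_trans[OF phase_rk reach_trans[OF phase_card_kernel_set reach_trans[OF phase_row_offset
      reach_trans[OF phase_threshold phase_output]]]]]]]]]]]]]]]] by simp
  show "nv I \<le> length (encode_mhv I)" for I by (simp add: length_encode)
  show "look (take 18 (stage I)) 17 = array_of (encode_mhv (kernel I))" for I
    by (simp add: look_def length_stage array_of_eq_tab)
  show "length (encode_mhv (kernel I)) \<le> poly [:3, 1, 1:] (nv I)" for I
    by (rule length_encode_kernel_le)
qed

theorem theorem8:
  "\<exists>(K :: nat mhv \<Rightarrow> nat mhv) (f :: nat \<Rightarrow> nat).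
     polytime_computable mhv_instances encode_mhv encode_mhv K \<and>
     (\<forall>I \<in> mhv_instances.
        K I \<in> mhv_instances \<and>
        (mhv_yes (K I) \<longleftrightarrow> mhv_yes I) \<and>
        card (verts (graph (K I))) \<le> f (dist_to_clique (graph I))) \<and>
     (\<lambda>d. real (f d)) \<in> O(\<lambda>d. real d ^ 3)"
proof -
  define f :: "nat \<Rightarrow> nat" where "f d = 2 * d + (2 * d + 3) * (2 * d * (4 * d + 3) + 2)" for d
  have kernel: "kernel I \<in> mhv_instances \<and> (mhv_yes (kernel I) \<longleftrightarrow> mhv_yes I) \<and>
      card (verts (graph (kernel I))) \<le> f (dist_to_clique (graph I))" if "I \<in> mhv_instances" for I
  proof -
    interpret kernelization I by unfold_locales (rule that)
    show ?thesis using kernel_instance mhv_yes_kernel card_verts_kernel by (simp add: f_def)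
  qed
  \<comment> \<open>The estimates give the factor 2 + 80, rounded up to 100. The bound fails for
    \<open>d = 0\<close>, where \<open>f\<close> is 6, but only large \<open>d\<close>
    matter.\<close>
  have "f d \<le> 100 * d ^ 3" if "1 \<le> d" for d
  proof -
    have "2 * d * (4 * d + 3) + 2 = 8 * (d * d) + 6 * d + 2" by (simp add: algebra_simps)
    moreover have "d \<le> d * d" by (rule le_square)
    ultimately have quadratic: "2 * d * (4 * d + 3) + 2 \<le> 16 * d ^ 2"
      using that unfolding power2_eq_square by linarith
    have "2 * d \<le> 2 * d ^ 3" using that by (simp add: power3_eq_cube)
    moreover have "(2 * d + 3) * (2 * d * (4 * d + 3) + 2) \<le> (5 * d) * (16 * d ^ 2)"
      using that quadratic by (intro mult_le_mono) auto
    ultimately have "f d \<le> 2 * d ^ 3 + (5 * d) * (16 * d ^ 2)" unfolding f_def by (rule add_mono)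
    then show ?thesis by (simp add: power3_eq_cube power2_eq_square)
  qed
  then have "real (f d) \<le> 100 * real d ^ 3" if "1 \<le> d" for d
    using that by (metis of_nat_le_iff of_nat_mult of_nat_numeral of_nat_power)
  then have "(\<lambda>d. real (f d)) \<in> O(\<lambda>d. real d ^ 3)"
    by (intro bigoI[of _ 100] eventually_at_top_linorderI[of 1]) simp
  then show ?thesis using polytime_kernel kernel by blast
qed

end
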